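(* Let $G=(V,E)$, $\mathcal{C}:E\to\{R,B\}$ be a 2-colored graph. Then \[\mathcal{T}(G,\mathcal{C})=\mathcal{A}(G,\mathcal{C})\cap\mathcal{Z}(G).\]
   Context: Graphs are finite and undirected; parallel edges are allowed, loops are not. A 2-colored graph is a graph whose edges are each colored red ($R$) or blue ($B$). A walk is a sequence $W=(v_0,e_1,v_1,\ldots,e_m,v_m)$ where each $e_j\in E$ has endpoints $v_{j-1},v_j$. It is a trail when its edges are distinct, closed when $v_0=v_m$, and a cycle when it is closed, its edges are distinct and $v_0,\ldots,v_{m-1}$ are distinct (so two parallel edges form a cycle of length 2). A closed alternating trail (CAT) is a closed trail with $\mathcal{C}(e_j)\ne\mathcal{C}(e_{j+1})$ for $j=1,\ldots,m-1$ and $\mathcal{C}(e_m)\ne\mathcal{C}(e_1)$. The characteristic vector of a walk is $\chi(W)=\sum_{i=1}^m\chi(e_i)\in\mathbb{R}^E$, where $\chi(e)$ is the unit vector of the coordinate $e$. The alternating cone $\mathcal{A}(G,\mathcal{C})$ is the set of $x=(x(e):e\in E)\in\mathbb{R}^E$ with $x(e)\ge0$ for all $e\in E$ and, for every $v\in V$, the balance condition $\sum_{e\in E_R(v)}x(e)=\sum_{e\in E_B(v)}x(e)$, where $E_R(v)$ and $E_B(v)$ are the sets of red and blue edges incident with $v$. The trail cone $\mathcal{T}(G,\mathcal{C})\subseteq\mathbb{R}^E$ is the convex cone generated by (the set of all nonnegative real linear combinations of) the characteristic vectors of the CAT's in $(G,\mathcal{C})$. $\mathcal{Z}(G)\subseteq\mathbb{R}^E$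 is the convex cone generated by the characteristic vectors of the cycles in $G$ (colors ignored). *)

theory Defs
  imports Complex_Main
begin

text \<open>Undirected multigraphs: an edge is an abstract object with a two-element set of endpoints,
  so parallel edges are possible and loops are not.\<close>

record ('v, 'e) mgraph =
  verts :: "'v set"
  edges :: "'e set"
  ends :: "'e \<Rightarrow> 'v set"

definition finite_mgraph :: "('v, 'e) mgraph \<Rightarrow> bool" where
  "finite_mgraph G \<longleftrightarrow> finite (verts G) \<and> finite (edges G) \<and>
     (\<forall>e \<in> edges G. ends G e \<subseteq> verts G \<and> card (ends G e) = 2)"

datatype color = Red | Blue

text \<open>The walk $(v_0,e_1,v_1,\dots,e_m,v_m)$ is the pair of lists
  $[v_0,\dots,v_m]$ and $[e_1,\dots,e_m]$; list indices start at 0, so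
  \<open>es ! i\<close> is $e_{i+1}$.\<close>

type_synonym ('v, 'e) walk = "'v list \<times> 'e list"

definition is_walk :: "('v, 'e) mgraph \<Rightarrow> ('v, 'e) walk \<Rightarrow> bool" where
  "is_walk G = (\<lambda>(vs, es). length vs = Suc (length es) \<and> set vs \<subseteq> verts G \<and> set es \<subseteq> edges G \<and>
     (\<forall>i < length es. ends G (es ! i) = {vs ! i, vs ! Suc i}))"

definition is_closed :: "('v, 'e) walk \<Rightarrow> bool" where
  "is_closed = (\<lambda>(vs, es). hd vs = last vs)"

definition is_trail :: "('v, 'e) mgraph \<Rightarrow> ('v, 'e) walk \<Rightarrow> bool" where
  "is_trail G W \<longleftrightarrow> is_walk G W \<and> distinct (snd W)"

text \<open>Walks without edges are neither cycles nor closed alternating trails. (Their characteristic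
  vector is 0, so they would not affect the generated cones.)\<close>

definition is_cycle :: "('v, 'e) mgraph \<Rightarrow> ('v, 'e) walk \<Rightarrow> bool" where
  "is_cycle G W \<longleftrightarrow> is_trail G W \<and> is_closed W \<and> snd W \<noteq> [] \<and> distinct (butlast (fst W))"

definition is_CAT :: "('v, 'e) mgraph \<Rightarrow> ('e \<Rightarrow> color) \<Rightarrow> ('v, 'e) walk \<Rightarrow> bool" where
  "is_CAT G C W \<longleftrightarrow> is_trail G W \<and> is_closed W \<and> snd W \<noteq> [] \<and>
     (\<forall>i. Suc i < length (snd W) \<longrightarrow> C (snd W ! i) \<noteq> C (snd W ! Suc i)) \<and>
     C (last (snd W)) \<noteq> C (hd (snd W))"

text \<open>The space $\mathbb{R}^E$ is rendered as the set of functions on the whole edge type that vanish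
  outside \<open>edges G\<close>.\<close>

definition edge_space :: "('v, 'e) mgraph \<Rightarrow> ('e \<Rightarrow> real) set" where
  "edge_space G = {x. \<forall>e. e \<notin> edges G \<longrightarrow> x e = 0}"

definition unit_vec :: "'e \<Rightarrow> 'e \<Rightarrow> real" where
  "unit_vec e = (\<lambda>e'. if e' = e then 1 else 0)"

definition char_vec :: "('v, 'e) walk \<Rightarrow> 'e \<Rightarrow> real" where
  "char_vec = (\<lambda>(vs, es) e. \<Sum>i < length es. unit_vec (es ! i) e)"

definition generated_cone :: "('e \<Rightarrow> real) set \<Rightarrow> ('e \<Rightarrow> real) set" where
  "generated_cone S = {(\<lambda>e. \<Sum>y\<in>F. c y * y e) | F c. finite F \<and> F \<subseteq> S \<and> (\<forall>y\<in>F. 0 \<le> c y)}"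

definition color_edges_at ::
  "('v, 'e) mgraph \<Rightarrow> ('e \<Rightarrow> color) \<Rightarrow> color \<Rightarrow> 'v \<Rightarrow> 'e set" where
  "color_edges_at G C k v = {e \<in> edges G. v \<in> ends G e \<and> C e = k}"

definition alternating_cone :: "('v, 'e) mgraph \<Rightarrow> ('e \<Rightarrow> color) \<Rightarrow> ('e \<Rightarrow> real) set" where
  "alternating_cone G C = {x \<in> edge_space G. (\<forall>e \<in> edges G. 0 \<le> x e) \<and>
     (\<forall>v \<in> verts G. (\<Sum>e \<in> color_edges_at G C Red v. x e) = (\<Sum>e \<in> color_edges_at G C Blue v. x e))}"

definition trail_cone :: "('v, 'e) mgraph \<Rightarrow> ('e \<Rightarrow> color) \<Rightarrow> ('e \<Rightarrow> real) set" where
  "trail_cone G C = generated_cone (char_vec ` {W. is_CAT G C W})"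

definition cycle_cone :: "('v, 'e) mgraph \<Rightarrow> ('e \<Rightarrow> real) set" where
  "cycle_cone G = generated_cone (char_vec ` {W. is_cycle G W})"

end

theory Submission
  imports Defs "HOL-Library.Indicator_Function"
begin

text \<open>The cone of the cycles enters only through the cut condition: a cycle that meets a cut does so in
  at least two edges, hence every \<open>x\<close> in the cone satisfies \<open>2 * x e \<le> sum x D\<close> for each edge \<open>e\<close> of each
  cut \<open>D\<close>. A balanced nonnegative \<open>x\<close> with this property is a nonnegative combination of
  balanced edge sets, and balanced edge sets are disjoint unions of CATs.

  For the middle claim, colors are attached to half-edges, and one argues by induction on the number of
  vertices and then on the support of \<open>x\<close>. If a cut with at least two vertices on either side is tight
  at \<open>e0\<close>, shrink either side to a vertex at which \<open>e0\<close> has one color and the other edges of the cut have the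
  other color. Every balanced set of either smaller graph meets the cut in nothing or in \<open>e0\<close> and one
  further edge, so the two decompositions can be glued. If there is no such cut, the support of \<open>x\<close> is
  bridgeless with both colors at each vertex. Kotzig's theorem (a graph with a perfect matching none of whose
  edges is a bridge has an alternating cycle), applied to the graph of half-edges matched along the edges,
  gives a balanced set \<open>F\<close> in the support. A maximal multiple of \<open>F\<close> is subtracted from \<open>x\<close>, until the
  support shrinks or a cut becomes tight; cuts around a single vertex need no attention, for there
  balance implies the cut condition.\<close>

section \<open>Alternating cycles and bridges\<close>

text \<open>A matching is recorded by its vertex set \<open>A\<close> alone. If \<open>A\<close> is
  moreover closed under a second perfect matching \<open>m\<close>, the pairs of both kinds make
  \<open>A\<close> a disjoint union of alternating cycles (a pair of both kinds counts as one of
  length 2), so that cycles need no representation as lists.\<close>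

inductive pmatch :: "('a \<Rightarrow> 'a \<Rightarrow> bool) \<Rightarrow> 'a set \<Rightarrow> bool" for N where
  empty: "pmatch N {}"
| insert2: "pmatch N A \<Longrightarrow> x \<notin> A \<Longrightarrow> y \<notin> A \<Longrightarrow> x \<noteq> y \<Longrightarrow> N x y \<Longrightarrow> pmatch N (insert x (insert y A))"

lemma pmatch_Un: "pmatch N A \<Longrightarrow> pmatch N B \<Longrightarrow> A \<inter> B = {} \<Longrightarrow> pmatch N (A \<union> B)"
  by (induction rule: pmatch.induct) (auto intro: pmatch.insert2)

lemma pmatch_mono_on:
  assumes "pmatch N A" "\<And>x y. x \<in> A \<Longrightarrow> y \<in> A \<Longrightarrow> N x y \<Longrightarrow> N' x y"
  shows "pmatch N' A"
  using assms by (induction rule: pmatch.induct) (auto intro: pmatch.intros)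

lemma pmatch_remove:
  assumes "symp N" "pmatch N A" "c \<in> A"
  shows "\<exists>z\<in>A. z \<noteq> c \<and> N c z \<and> pmatch N (A - {c, z})"
  using assms(2,3)
proof (induction rule: pmatch.induct)
  case (insert2 A x y)
  consider "c = x" | "c = y" | "c \<in> A" using insert2.prems by auto
  then show ?case
  proof cases
    case 1
    then have "insert x (insert y A) - {c, y} = A" using insert2.hyps by auto
    then show ?thesis using insert2.hyps 1 by (intro bexI[of _ y]) auto
  next
    case 2
    then have "insert x (insert y A) - {c, x} = A" using insert2.hyps by auto
    moreover have "N y x" using assms(1) insert2.hyps(5) by (rule sympD)
    ultimately show ?thesis using insert2.hyps 2 by (intro bexI[of _ x]) auto
  next
    case 3
    then obtain z where z: "z \<in> A" "z \<noteq> c" "N c z" "pmatch N (A - {c, z})"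
      using insert2.IH by blast
    have "insert x (insert y A) - {c, z} = insert x (insert y (A - {c, z}))"
      using 3 z insert2.hyps by auto
    moreover have "pmatch N (insert x (insert y (A - {c, z})))"
      using z insert2.hyps by (intro pmatch.insert2) auto
    ultimately show ?thesis using z by (intro bexI[of _ z]) auto
  qed
qed simp

text \<open>An alternating path from \<open>a\<close> to \<open>b\<close> with vertex set
  \<open>P\<close> whose first and last edges belong to the matching \<open>m\<close>; without its
  two ends, \<open>P\<close> is therefore matched by \<open>N\<close>.\<close>

inductive apath :: "'a set \<Rightarrow> ('a \<Rightarrow> 'a) \<Rightarrow> ('a \<Rightarrow> 'a \<Rightarrow> bool) \<Rightarrow> 'a \<Rightarrow> 'a \<Rightarrow> 'a set \<Rightarrow> bool"
  for X m N where
  edge: "a \<in> X \<Longrightarrow> apath X m N a (m a) {a, m a}"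
| extend: "apath X m N a b P \<Longrightarrow> N b c \<Longrightarrow> c \<notin> P \<Longrightarrow>
    apath X m N a (m c) (insert c (insert (m c) P))"

text \<open>The fixed-point-free involution \<open>m\<close> is the perfect matching;
  \<open>N\<close> is the adjacency that supplies the other edges of alternating paths and
  cycles.\<close>

locale matched_graph =
  fixes X :: "'a set" and m :: "'a \<Rightarrow> 'a" and N :: "'a \<Rightarrow> 'a \<Rightarrow> bool"
  assumes finite_X: "finite X"
    and m_in: "x \<in> X \<Longrightarrow> m x \<in> X"
    and m_m: "x \<in> X \<Longrightarrow> m (m x) = x"
    and m_neq: "x \<in> X \<Longrightarrow> m x \<noteq> x"
    and N_in: "N x y \<Longrightarrow> x \<in> X \<and> y \<in> X"
    and N_sym: "symp N"
    and N_irrefl: "\<not> N x x"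
begin

lemma apath_set:
  "apath X m N a b P \<Longrightarrow> a \<in> P \<and> b \<in> P \<and> a \<noteq> b \<and> P \<subseteq> X \<and> m ` P \<subseteq> P"
proof (induction rule: apath.induct)
  case (edge a)
  then show ?case using m_in m_m m_neq[OF edge] by auto
next
  case (extend a b P c)
  have c: "c \<in> X" using extend N_in by blast
  have "m c \<notin> P"
    using extend.IH extend.hyps(3) m_m[OF c] by force
  then show ?case using extend c m_in m_m by auto
qed

lemma apath_fresh:
  assumes "apath X m N a b P" "c \<in> X" "c \<notin> P"
  shows "m c \<notin> P"
  using apath_set[OF assms(1)] assms(2,3) m_m by force

lemma apath_pmatch: "apath X m N a b P \<Longrightarrow> pmatch N (P - {a, b})"
proof (induction rule: apath.induct)
  case (edge a)
  then show ?case by (simp add: pmatch.empty)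
next
  case (extend a b P c)
  note * = apath_set[OF extend.hyps(1)]
  have c: "c \<in> X" using extend N_in by blast
  have "m c \<notin> P" using apath_fresh extend c by blast
  then have "insert c (insert (m c) P) - {a, m c} = insert b (insert c (P - {a, b}))"
    using * extend.hyps m_neq[OF c] by auto
  then show ?case using extend * by (auto intro!: pmatch.insert2)
qed

text \<open>Each matching pair is traversed in one direction: its second vertex ends an initial
  segment, its first vertex begins a final segment, and either segment is again an alternating
  path.\<close>

lemma apath_end_to:
  assumes "apath X m N a b P" "q \<in> P"
  shows "\<exists>P'\<subseteq>P. apath X m N a q P' \<or> apath X m N q b P'"
  using assms
proof (induction rule: apath.induct)
  case (edge a)
  then show ?case using apath.edge[of a X m N] by auto
next
  case (extend a b P c)
  have c: "c \<in> X" using extend N_in by blast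
  consider "q = m c" | "q = c" | "q \<in> P" using extend.prems by blast
  then show ?case
  proof cases
    case 1
    then have "apath X m N a q (insert c (insert (m c) P))"
      using apath.extend[OF extend.hyps] by simp
    then show ?thesis by (intro exI[of _ "insert c (insert (m c) P)"]) simp
  next
    case 2
    then have "apath X m N q (m c) {c, m c}" using apath.edge[OF c, of m N] by simp
    then show ?thesis by (intro exI[of _ "{c, m c}"]) simp
  next
    case 3
    then obtain P' where P': "P' \<subseteq> P" "apath X m N a q P' \<or> apath X m N q b P'"
      using extend.IH by blast
    from P'(2) show ?thesis
    proof
      assume "apath X m N q b P'"
      then have "apath X m N q (m c) (insert c (insert (m c) P'))"
        using extend.hyps P'(1) by (intro apath.extend) auto
      then show ?thesis using P'(1) by (intro exI[of _ "insert c (insert (m c) P')"]) auto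
    qed (use P'(1) in blast)
  qed
qed

text \<open>If \<open>c\<close> is the first vertex of its matching pair, the final segment from
  \<open>c\<close> is taken. If it is the second, the path goes on along \<open>N\<close> to some
  \<open>a'\<close>, and the final segment from \<open>a'\<close> omits \<open>c\<close>. Together
  with an edge of \<open>N\<close> from \<open>b\<close> back to \<open>c\<close>, the first case
  gives an alternating cycle and the second a blossom based at \<open>c\<close>.\<close>

lemma apath_split:
  assumes "apath X m N a b P" "c \<in> P" "c \<noteq> b"
  shows "\<exists>P'\<subseteq>P. apath X m N c b P' \<or> (c \<notin> P' \<and> (\<exists>a'. N c a' \<and> apath X m N a' b P'))"
  using assms
proof (induction rule: apath.induct)
  case (edge a)
  then show ?case using apath.edge[of a X m N] by auto
next
  case (extend a b P d)
  have d: "d \<in> X" using extend N_in by blast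
  note E = apath.edge[OF d, of m N]
  consider "c = d" | "c = b" "c \<noteq> d" "c \<noteq> m d" | "c \<in> P" "c \<noteq> b"
    using extend.prems by blast
  then show ?case
  proof cases
    case 1
    then show ?thesis using E by (intro exI[of _ "{d, m d}"]) simp
  next
    case 2
    then show ?thesis using E extend.hyps
      by (intro exI[of _ "{d, m d}"]) fast
  next
    case 3
    then obtain P' where P': "P' \<subseteq> P"
      "apath X m N c b P' \<or> (c \<notin> P' \<and> (\<exists>a'. N c a' \<and> apath X m N a' b P'))"
      using extend.IH by blast
    have "d \<notin> P'" using P' extend.hyps by auto
    then have "apath X m N z b P' \<Longrightarrow> apath X m N z (m d) (insert d (insert (m d) P'))" for z
      using apath.extend extend.hyps by fast
    moreover have "c \<noteq> d" "c \<noteq> m d" using 3 extend by auto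
    ultimately show ?thesis using P'
      by (intro exI[of _ "insert d (insert (m d) P')"]) blast
  qed
qed

text \<open>The set \<open>P \<union> {c}\<close> is a blossom with base \<open>c\<close>: whichever of its vertices is matched to the
  outside, an alternating path leads from there to the base.\<close>
lemma blossom_pmatch:
  assumes P: "apath X m N a b P" and c: "c \<notin> P" "N c a" "N b c" and q: "q \<in> P"
  shows "\<exists>P'\<subseteq>P. q \<in> P' \<and> m ` P' \<subseteq> P' \<and> pmatch N (insert c P' - {q})"
proof -
  obtain P' where P': "P' \<subseteq> P" "apath X m N a q P' \<or> apath X m N q b P'"
    using apath_end_to[OF P q] by blast
  have cb: "N c b" using sympD[OF N_sym c(3)] .
  from P'(2) show ?thesis
  proof
    assume A: "apath X m N a q P'"
    have "insert c P' - {q} = insert c (insert a (P' - {a, q}))"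
      using apath_set[OF A] P'(1) c(1) q by auto
    then have "pmatch N (insert c P' - {q})"
      using apath_pmatch[OF A] apath_set[OF A] P'(1) c
      by (auto intro!: pmatch.insert2)
    then show ?thesis using apath_set[OF A] P'(1) by blast
  next
    assume A: "apath X m N q b P'"
    have "insert c P' - {q} = insert c (insert b (P' - {q, b}))"
      using apath_set[OF A] P'(1) c(1) q by auto
    then have "pmatch N (insert c P' - {q})"
      using apath_pmatch[OF A] apath_set[OF A] P'(1) c cb
      by (auto intro!: pmatch.insert2)
    then show ?thesis using apath_set[OF A] P'(1) by blast
  qed
qed

text \<open>An alternating path with the most vertices cannot be extended, so a neighbor
  \<open>c\<close> of its end \<open>b\<close> lies on it. The edge from \<open>b\<close> to
  \<open>c\<close> closes an alternating cycle or a blossom, according to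
  \<open>apath_split\<close>.\<close>

lemma blossom_or_cycle:
  assumes nonempty: "X \<noteq> {}" and nbr: "\<And>x. x \<in> X \<Longrightarrow> \<exists>y. N x y"
  shows "(\<exists>Y\<subseteq>X. Y \<noteq> {} \<and> m ` Y \<subseteq> Y \<and> pmatch N Y) \<or>
    (\<exists>a b c P. apath X m N a b P \<and> c \<notin> P \<and> N c a \<and> N b c)"
proof -
  obtain x where x: "x \<in> X" using nonempty by blast
  let ?Q = "\<lambda>P. \<exists>a b. apath X m N a b P"
  have "?Q {x, m x}" using apath.edge[OF x] by blast
  moreover have "\<forall>P. ?Q P \<longrightarrow> card P < Suc (card X)"
    using apath_set card_mono[OF finite_X] by (metis less_Suc_eq_le)
  ultimately obtain P where "?Q P" and max: "\<And>P'. ?Q P' \<Longrightarrow> card P' \<le> card P"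
    using ex_has_greatest_nat[of ?Q "{x, m x}" card "Suc (card X)"] by blast
  then obtain a b where P: "apath X m N a b P" by blast
  note * = apath_set[OF P]
  obtain c where c: "N b c" using nbr * by blast
  have "c \<in> P"
  proof (rule ccontr)
    assume "c \<notin> P"
    then have "?Q (insert c (insert (m c) P))" using apath.extend[OF P c] by blast
    then have "card (insert c (insert (m c) P)) \<le> card P" using max by blast
    moreover have "finite P" using * finite_X finite_subset by blast
    ultimately have "P = insert c (insert (m c) P)"
      using card_seteq[of "insert c (insert (m c) P)" P] by blast
    then show False using \<open>c \<notin> P\<close> by blast
  qed
  moreover have "c \<noteq> b" using c N_irrefl by blast
  ultimately obtain P' where P': "P' \<subseteq> P"
    "apath X m N c b P' \<or> (c \<notin> P' \<and> (\<exists>a'. N c a' \<and> apath X m N a' b P'))"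
    using apath_split[OF P, of c] by metis
  from P'(2) show ?thesis
  proof (elim disjE)
    assume A: "apath X m N c b P'"
    \<comment> \<open>The edge between \<open>b\<close> and \<open>c\<close> matches the two ends
      that \<open>apath_pmatch\<close> leaves out.\<close>
    have "P' = insert b (insert c (P' - {c, b}))" using apath_set[OF A] by auto
    moreover have "pmatch N (insert b (insert c (P' - {c, b})))"
      using apath_pmatch[OF A] c \<open>c \<noteq> b\<close> by (intro pmatch.insert2) auto
    ultimately have "pmatch N P'" by simp
    then have "P' \<subseteq> X \<and> P' \<noteq> {} \<and> m ` P' \<subseteq> P' \<and> pmatch N P'"
      using apath_set[OF A] by auto
    then show ?thesis by metis
  next
    assume "c \<notin> P' \<and> (\<exists>a'. N c a' \<and> apath X m N a' b P')"
    then show ?thesis using c by metis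
  qed
qed

end

text \<open>The last hypothesis says that no matching edge is a bridge: if \<open>a\<close> and
  \<open>m a\<close> form the only matching pair that leaves \<open>S\<close>, some edge of
  \<open>N\<close> leaves \<open>S\<close> too. By induction on \<open>X\<close>, either a cycle is
  found, or a blossom is contracted to its base \<open>c\<close>. The contraction inherits the
  hypothesis, and a solution there lifts back by \<open>blossom_pmatch\<close>.\<close>

lemma kotzig:
  assumes "matched_graph X m N" "X \<noteq> {}"
    and "\<And>a S. a \<in> S \<Longrightarrow> S \<subseteq> X \<Longrightarrow> m a \<notin> S \<Longrightarrow> (\<forall>y\<in>S. y \<noteq> a \<longrightarrow> m y \<in> S) \<Longrightarrow>
        \<exists>y\<in>S. \<exists>z\<in>X - S. N y z"
  shows "\<exists>Y\<subseteq>X. Y \<noteq> {} \<and> m ` Y \<subseteq> Y \<and> pmatch N Y"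
proof -
  have "finite X" using assms(1) by (rule matched_graph.finite_X)
  then show ?thesis using assms
  proof (induction X arbitrary: N rule: finite_psubset_induct)
    case (psubset X)
    interpret matched_graph X m N by fact
    have nbr: "\<exists>y. N x y" if "x \<in> X" for x
      using psubset.prems(3)[of x "{x}"] that m_neq by auto
    have "(\<exists>Y\<subseteq>X. Y \<noteq> {} \<and> m ` Y \<subseteq> Y \<and> pmatch N Y) \<or>
      (\<exists>a b c P. apath X m N a b P \<and> c \<notin> P \<and> N c a \<and> N b c)"
      using psubset.prems(2) nbr by (rule blossom_or_cycle)
    then show ?case
    proof (elim disjE)
      assume "\<exists>a b c P. apath X m N a b P \<and> c \<notin> P \<and> N c a \<and> N b c"
      then obtain a b c P where P: "apath X m N a b P" and c: "c \<notin> P" "N c a" "N b c" by blast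
      note PX = apath_set[OF P]
      have cX: "c \<in> X" using c N_in by blast
      have mP: "m y \<notin> P" if "y \<in> X" "y \<notin> P" for y using apath_fresh[OF P that] .
      define X' where "X' = X - P"
      \<comment> \<open>The contracted graph: \<open>c\<close> inherits the neighbors of
        \<open>P\<close>, and the condition \<open>x \<noteq> y\<close> discards the loops that
        arise.\<close>
      define N' where "N' x y \<longleftrightarrow> x \<in> X' \<and> y \<in> X' \<and> x \<noteq> y \<and>
        (N x y \<or> (x = c \<and> (\<exists>q\<in>P. N q y)) \<or> (y = c \<and> (\<exists>q\<in>P. N q x)))" for x y
      have sym: "N y x" if "N x y" for x y using sympD[OF N_sym that] .
      have sym_iff: "N x y \<longleftrightarrow> N y x" for x y using sym by blast
      interpret c: matched_graph X' m N'
        by unfold_locales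
          (use mP sym_iff in \<open>auto simp: X'_def N'_def finite_X m_in m_m m_neq intro!: sympI\<close>)
      have "\<exists>y\<in>S. \<exists>z\<in>X' - S. N' y z"
        if S: "d \<in> S" "S \<subseteq> X'" "m d \<notin> S" "\<forall>y\<in>S. y \<noteq> d \<longrightarrow> m y \<in> S" for d S
      proof -
        \<comment> \<open>The preimage of \<open>S\<close> under the contraction; an edge leaving
          \<open>T\<close> is then mapped to an edge leaving \<open>S\<close>.\<close>
        define T where "T = (if c \<in> S then S \<union> P else S)"
        have dX: "d \<in> X" "d \<notin> P" using S unfolding X'_def by auto
        have "\<forall>y\<in>T. y \<noteq> d \<longrightarrow> m y \<in> T"
          using S(4) PX unfolding T_def by auto
        moreover have "m d \<notin> T" using S(3) mP[OF dX] unfolding T_def by auto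
        moreover have "T \<subseteq> X" "d \<in> T" using S PX unfolding T_def X'_def by auto
        ultimately obtain y z where yz: "y \<in> T" "z \<in> X - T" "N y z"
          using psubset.prems(3)[of d T] by blast
        show ?thesis
        proof (cases "c \<in> S")
          case True
          then have z: "z \<in> X' - S" using yz unfolding T_def X'_def by auto
          show ?thesis
          proof (cases "y \<in> P")
            case True
            then have "N' c z" using z yz \<open>c \<in> S\<close> S(2) unfolding N'_def by auto
            then show ?thesis using z \<open>c \<in> S\<close> by blast
          next
            case False
            then have "y \<in> S" using yz unfolding T_def by (auto split: if_splits)
            then show ?thesis using z yz S(2) unfolding N'_def by blast
          qed
        next
          case False
          then have y: "y \<in> S" using yz unfolding T_def by auto
          show ?thesis
          proof (cases "z \<in> P")
            case True
            then have "N' y c" using y yz S(2) sym False cX c(1) unfolding N'_def X'_def by blast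
            moreover have "c \<in> X' - S" using False cX c(1) unfolding X'_def by auto
            ultimately show ?thesis using y by blast
          next
            case z: False
            then have "z \<in> X' - S" using yz False unfolding T_def X'_def by auto
            then show ?thesis using y yz S(2) unfolding N'_def by blast
          qed
        qed
      qed
      moreover have "X' \<subset> X" using PX unfolding X'_def by blast
      moreover have "X' \<noteq> {}" using cX c(1) unfolding X'_def by auto
      ultimately obtain Y where Y: "Y \<subseteq> X'" "Y \<noteq> {}" "m ` Y \<subseteq> Y" "pmatch N' Y"
        using psubset.IH[of X' N'] c.matched_graph_axioms by blast
      have N'N: "N x y" if "N' x y" "x \<noteq> c" "y \<noteq> c" for x y using that unfolding N'_def by auto
      show ?thesis
      proof (cases "c \<in> Y")
        case False
        then have "pmatch N Y" using N'N by (intro pmatch_mono_on[OF Y(4)]) auto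
        then show ?thesis using Y unfolding X'_def by blast
      next
        case True
        then obtain z where z: "z \<in> Y" "z \<noteq> c" "N' c z" "pmatch N' (Y - {c, z})"
          using pmatch_remove[OF c.N_sym Y(4)] by blast
        have pm: "pmatch N (Y - {c, z})" using N'N by (intro pmatch_mono_on[OF z(4)]) auto
        show ?thesis
        proof (cases "N c z")
          case True
          have "Y = insert c (insert z (Y - {c, z}))" using \<open>c \<in> Y\<close> z by auto
          moreover have "pmatch N (insert c (insert z (Y - {c, z})))"
            using True z pm by (intro pmatch.insert2) auto
          ultimately have "pmatch N Y" by simp
          then show ?thesis using Y unfolding X'_def by blast
        next
          case False
          \<comment> \<open>The edge from \<open>c\<close> to \<open>z\<close> stems from some
            \<open>q\<close> in \<open>P\<close>. The blossom is rematched so that \<open>c\<close>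
            is covered inside it and \<open>q\<close> is left over for \<open>z\<close>.\<close>
          then obtain q where q: "q \<in> P" "N q z" using z unfolding N'_def by blast
          obtain P' where P': "P' \<subseteq> P" "q \<in> P'" "m ` P' \<subseteq> P'" "pmatch N (insert c P' - {q})"
            using blossom_pmatch[OF P c q(1)] by blast
          have disj: "P \<inter> Y = {}" using Y(1) unfolding X'_def by auto
          have "pmatch N ((insert c P' - {q}) \<union> (Y - {c, z}))"
            using P' pm disj by (intro pmatch_Un) auto
          then have "pmatch N (insert q (insert z ((insert c P' - {q}) \<union> (Y - {c, z}))))"
            using q z disj P' by (intro pmatch.insert2) auto
          moreover have "insert q (insert z ((insert c P' - {q}) \<union> (Y - {c, z}))) = P' \<union> Y"
            using P' \<open>c \<in> Y\<close> z by auto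
          ultimately have "pmatch N (P' \<union> Y)" by simp
          moreover have "P' \<union> Y \<subseteq> X" using P' Y PX unfolding X'_def by auto
          moreover have "m ` (P' \<union> Y) \<subseteq> P' \<union> Y" using P' Y by auto
          ultimately show ?thesis using Y(2) by (intro exI[of _ "P' \<union> Y"]) auto
        qed
      qed
    qed
  qed
qed

section \<open>Generated cones\<close>

lemma generated_coneI:
  "finite F \<Longrightarrow> F \<subseteq> S \<Longrightarrow> (\<And>y. y \<in> F \<Longrightarrow> 0 \<le> c y) \<Longrightarrow> (\<And>e. x e = (\<Sum>y\<in>F. c y * y e)) \<Longrightarrow>
    x \<in> generated_cone S"
  unfolding generated_cone_def by blast

lemma generated_coneE:
  assumes "x \<in> generated_cone S"
  obtains F c where "finite F" "F \<subseteq> S" "\<And>y. y \<in> F \<Longrightarrow> 0 \<le> c y" "x = (\<lambda>e. \<Sum>y\<in>F. c y * y e)"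
  using assms unfolding generated_cone_def by blast

lemma generated_cone_zero: "(\<lambda>_. 0) \<in> generated_cone S"
  by (rule generated_coneI[of "{}"]) auto

lemma generated_cone_scaled:
  assumes "y \<in> S" "0 \<le> t"
  shows "(\<lambda>e. t * y e) \<in> generated_cone S"
  by (rule generated_coneI[of "{y}" _ "\<lambda>_. t"]) (use assms in auto)

lemma generated_cone_add:
  assumes "x \<in> generated_cone S" "y \<in> generated_cone S"
  shows "(\<lambda>e. x e + y e) \<in> generated_cone S"
proof -
  obtain F c where F: "finite F" "F \<subseteq> S" "\<And>y. y \<in> F \<Longrightarrow> 0 \<le> c y" "x = (\<lambda>e. \<Sum>y\<in>F. c y * y e)"
    using assms(1) by (rule generated_coneE) blast
  obtain H d where H: "finite H" "H \<subseteq> S" "\<And>y. y \<in> H \<Longrightarrow> 0 \<le> d y" "y = (\<lambda>e. \<Sum>y\<in>H. d y * y e)"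
    using assms(2) by (rule generated_coneE) blast
  let ?c = "\<lambda>z. (if z \<in> F then c z else 0) + (if z \<in> H then d z else 0)"
  show ?thesis
  proof (rule generated_coneI[of "F \<union> H" _ ?c])
    show "x e + y e = (\<Sum>z\<in>F \<union> H. ?c z * z e)" for e
    proof -
      have "(\<Sum>z\<in>F. c z * z e) = (\<Sum>z\<in>F \<union> H. (if z \<in> F then c z else 0) * z e)"
        using F(1) H(1) by (intro sum.mono_neutral_cong_left) auto
      moreover have "(\<Sum>z\<in>H. d z * z e) = (\<Sum>z\<in>F \<union> H. (if z \<in> H then d z else 0) * z e)"
        using F(1) H(1) by (intro sum.mono_neutral_cong_left) auto
      ultimately show ?thesis by (simp only: F(4) H(4) distrib_right sum.distrib)
    qed
  qed (use F H in auto)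
qed

lemma generated_cone_scale:
  assumes "x \<in> generated_cone S" "0 \<le> t"
  shows "(\<lambda>e. t * x e) \<in> generated_cone S"
proof -
  obtain F c where F: "finite F" "F \<subseteq> S" "\<And>y. y \<in> F \<Longrightarrow> 0 \<le> c y" "x = (\<lambda>e. \<Sum>y\<in>F. c y * y e)"
    using assms(1) by (rule generated_coneE) blast
  show ?thesis
    by (rule generated_coneI[of F _ "\<lambda>y. t * c y"])
      (use F assms(2) in \<open>auto simp: sum_distrib_left mult.assoc\<close>)
qed

lemma generated_cone_sum:
  assumes "finite I" "\<And>i. i \<in> I \<Longrightarrow> f i \<in> generated_cone S"
  shows "(\<lambda>e. \<Sum>i\<in>I. f i e) \<in> generated_cone S"
  using assms
  by (induction I rule: finite_induct) (auto intro: generated_cone_zero generated_cone_add)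

lemma generated_cone_subset:
  assumes "S \<subseteq> generated_cone S'"
  shows "generated_cone S \<subseteq> generated_cone S'"
proof
  fix x assume "x \<in> generated_cone S"
  then obtain F c where F: "finite F" "F \<subseteq> S" "\<And>y. y \<in> F \<Longrightarrow> 0 \<le> c y"
    "x = (\<lambda>e. \<Sum>y\<in>F. c y * y e)" by (rule generated_coneE) blast
  then show "x \<in> generated_cone S'"
    using assms by (auto intro!: generated_cone_sum generated_cone_scale)
qed

lemma inj_indicator: "inj (indicator :: 'e set \<Rightarrow> 'e \<Rightarrow> real)"
  by (rule injI) (metis indicator_eq_1_iff subsetI subset_antisym)

text \<open>Since \<open>indicator\<close> is injective, coefficients can be indexed by the sets
  themselves, with \<open>0\<close> as the default for sets that do not occur.\<close>

lemma generated_cone_indicatorE: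
  assumes "x \<in> generated_cone (indicator ` B)" "finite B"
  obtains c where "\<And>F. 0 \<le> c F" "\<And>e. x e = (\<Sum>F\<in>B. c F * indicator F e)"
proof -
  obtain H d where H: "finite H" "H \<subseteq> indicator ` B" "\<And>y. y \<in> H \<Longrightarrow> 0 \<le> d y"
    "x = (\<lambda>e. \<Sum>y\<in>H. d y * y e)" using assms(1) by (rule generated_coneE) blast
  let ?c = "\<lambda>F. if indicator F \<in> H then d (indicator F) else 0"
  have "x e = (\<Sum>F\<in>B. ?c F * indicator F e)" for e
  proof -
    have "x e = (\<Sum>y\<in>indicator ` B. (if y \<in> H then d y else 0) * y e)"
      unfolding H(4) using H(1,2) assms(2) by (intro sum.mono_neutral_cong_left) auto
    also have "\<dots> = (\<Sum>F\<in>B. ?c F * indicator F e)"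
      by (subst sum.reindex[OF inj_on_subset[OF inj_indicator]]) auto
    finally show ?thesis .
  qed
  then show thesis using that[of ?c] H(3) by auto
qed

section \<open>Gluing two conic combinations along common edges\<close>

text \<open>The product weights \<open>c F * c' F' / s\<close> on pairs have \<open>c\<close> as
  their first marginal because \<open>c'\<close> sums to \<open>s\<close>. For \<open>s = 0\<close>
  nonnegativity makes all \<open>c F\<close> with \<open>F\<close> in \<open>A\<close> vanish, in
  accordance with \<open>inverse 0 = 0\<close>.\<close>

lemma sum_pairs_indicator:
  fixes c c' :: "'e set \<Rightarrow> real"
  assumes "finite A" "\<And>F. 0 \<le> c F" "sum c A = s" "sum c' A' = s"
    and "\<And>F F'. F \<in> A \<Longrightarrow> F' \<in> A' \<Longrightarrow> (g \<in> F \<union> F') = (g \<in> F)"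
  shows "inverse s * (\<Sum>F\<in>A. \<Sum>F'\<in>A'. c F * c' F' * indicator (F \<union> F') g) = (\<Sum>F\<in>A. c F * indicator F g)"
proof -
  have "(\<Sum>F\<in>A. \<Sum>F'\<in>A'. c F * c' F' * indicator (F \<union> F') g)
      = (\<Sum>F\<in>A. \<Sum>F'\<in>A'. c F * indicator F g * c' F')"
    using assms(5) by (intro sum.cong refl) (auto simp: indicator_def)
  also have "\<dots> = (\<Sum>F\<in>A. c F * indicator F g) * s"
    using assms(4) by (simp add: sum_distrib_left[symmetric] sum_distrib_right[symmetric])
  finally have *: "(\<Sum>F\<in>A. \<Sum>F'\<in>A'. c F * c' F' * indicator (F \<union> F') g) = \<dots>" .
  show ?thesis
  proof (cases "s = 0")
    case True
    then have "\<forall>F\<in>A. c F = 0" using assms(1-3) by (simp add: sum_nonneg_eq_0_iff)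
    then show ?thesis by simp
  qed (simp add: *)
qed

text \<open>Grouping by the trace on \<open>D\<close> partitions \<open>A\<close>, as the admissible
  traces are pairwise distinct.\<close>

lemma sum_trace_split:
  fixes h :: "'e set \<Rightarrow> real"
  assumes "finite D" "finite A"
    and A: "\<And>F. F \<in> A \<Longrightarrow> F \<inter> D = {} \<or> (\<exists>f\<in>D - {e0}. F \<inter> D = {e0, f})"
  shows "sum h A = sum h {F \<in> A. F \<inter> D = {}} + (\<Sum>f\<in>D - {e0}. sum h {F \<in> A. F \<inter> D = {e0, f}})"
proof -
  define R where "R = {F \<in> A. F \<inter> D = {}}"
  define Q where "Q f = {F \<in> A. F \<inter> D = {e0, f}}" for f
  define U where "U = (\<Union>f\<in>D - {e0}. Q f)"
  have fin: "finite R" "finite (Q f)" "finite U" for f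
    using assms(1,2) unfolding R_def Q_def U_def by simp_all
  have "F \<in> R \<union> U" if "F \<in> A" for F
    using that A[OF that] unfolding R_def U_def Q_def by simp
  then have eq: "A = R \<union> U" unfolding R_def U_def Q_def by blast
  have disj: "R \<inter> U = {}"
  proof -
    have "F \<notin> U" if "F \<in> R" for F using that unfolding R_def U_def Q_def by simp
    then show ?thesis by blast
  qed
  have Q_disj: "Q f \<inter> Q f' = {}" if "f \<in> D - {e0}" "f' \<in> D - {e0}" "f \<noteq> f'" for f f'
  proof -
    have "{e0, f} \<noteq> {e0, f'}" using that by (simp add: doubleton_eq_iff)
    then have "F \<notin> Q f'" if "F \<in> Q f" for F using that unfolding Q_def by simp
    then show ?thesis by blast
  qed
  have "sum h A = sum h R + sum h U"
    unfolding eq by (rule sum.union_disjoint[OF fin(1) fin(3) disj])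
  also have "sum h U = (\<Sum>f\<in>D - {e0}. sum h (Q f))"
    unfolding U_def using assms(1) fin(2) Q_disj by (intro sum.UNION_disjoint) simp_all
  finally show ?thesis unfolding R_def Q_def .
qed

text \<open>For each common edge \<open>f\<close> other than \<open>e0\<close>, the sets with trace
  \<open>{e0, f}\<close> are exactly those that contain \<open>f\<close>, so they have total weight
  \<open>x f\<close> in both combinations. They are united in pairs with product weights, while sets
  that avoid the common edges are kept. Summing over the traces recovers \<open>x\<close> on either
  side.\<close>

lemma glue_cones:
  fixes x :: "'e \<Rightarrow> real"
  assumes fin: "finite E1" "finite E2"
    and B1: "\<And>F. F \<in> B1 \<Longrightarrow> F \<subseteq> E1"
    and trace1: "\<And>F. F \<in> B1 \<Longrightarrow>
      F \<inter> (E1 \<inter> E2) = {} \<or> (\<exists>f\<in>E1 \<inter> E2 - {e0}. F \<inter> (E1 \<inter> E2) = {e0, f})"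
    and B2: "\<And>F. F \<in> B2 \<Longrightarrow> F \<subseteq> E2"
    and trace2: "\<And>F. F \<in> B2 \<Longrightarrow>
      F \<inter> (E1 \<inter> E2) = {} \<or> (\<exists>f\<in>E1 \<inter> E2 - {e0}. F \<inter> (E1 \<inter> E2) = {e0, f})"
    and x1: "(\<lambda>e. x e * indicator E1 e) \<in> generated_cone (indicator ` B1)"
    and x2: "(\<lambda>e. x e * indicator E2 e) \<in> generated_cone (indicator ` B2)"
    and nonneg: "\<And>e. 0 \<le> x e" and supp: "\<And>e. e \<notin> E1 \<union> E2 \<Longrightarrow> x e = 0"
    and B: "\<And>F. F \<in> B1 \<Longrightarrow> F \<inter> (E1 \<inter> E2) = {} \<Longrightarrow> F \<in> B"
      "\<And>F. F \<in> B2 \<Longrightarrow> F \<inter> (E1 \<inter> E2) = {} \<Longrightarrow> F \<in> B"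
      "\<And>F F'. F \<in> B1 \<Longrightarrow> F' \<in> B2 \<Longrightarrow> F \<inter> (E1 \<inter> E2) = F' \<inter> (E1 \<inter> E2) \<Longrightarrow> F \<union> F' \<in> B"
  shows "x \<in> generated_cone (indicator ` B)"
proof -
  define D where "D = E1 \<inter> E2"
  have finD: "finite D" using fin unfolding D_def by simp
  have finB: "finite B1" "finite B2"
  proof -
    have "B1 \<subseteq> Pow E1" "B2 \<subseteq> Pow E2" using B1 B2 by auto
    then show "finite B1" "finite B2" using fin finite_subset by blast+
  qed
  obtain c where c: "\<And>F. 0 \<le> c F" "\<And>e. x e * indicator E1 e = (\<Sum>F\<in>B1. c F * indicator F e)"
    using x1 finB(1) by (rule generated_cone_indicatorE) blast
  obtain d where d: "\<And>F. 0 \<le> d F" "\<And>e. x e * indicator E2 e = (\<Sum>F\<in>B2. d F * indicator F e)"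
    using x2 finB(2) by (rule generated_cone_indicatorE) blast
  define R where "R A = {F \<in> A. F \<inter> D = {}}" for A
  define Q where "Q A f = {F \<in> A. F \<inter> D = {e0, f}}" for A f
  define D' where "D' = D - {e0}"
  have finR: "finite (R B1)" "finite (R B2)" "finite (Q B1 f)" "finite (Q B2 f)" for f
    using finB unfolding R_def Q_def by auto
  have split: "sum h A = sum h (R A) + (\<Sum>f\<in>D'. sum h (Q A f))"
    if "finite A" "\<And>F. F \<in> A \<Longrightarrow> F \<inter> D = {} \<or> (\<exists>f\<in>D - {e0}. F \<inter> D = {e0, f})"
    for A and h :: "'e set \<Rightarrow> real"
    unfolding R_def Q_def D'_def by (rule sum_trace_split[OF finD that])
  have weight: "sum c (Q A f) = (\<Sum>F\<in>A. c F * indicator F f)"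
    if "f \<in> D'" "finite A" and A: "\<And>F. F \<in> A \<Longrightarrow> F \<inter> D = {} \<or> (\<exists>f\<in>D - {e0}. F \<inter> D = {e0, f})"
    for A f and c :: "'e set \<Rightarrow> real"
  proof -
    have f: "f \<in> D" "f \<noteq> e0" using that(1) by (simp_all add: D'_def)
    have "F \<inter> D = {e0, f} \<longleftrightarrow> f \<in> F" if "F \<in> A" for F
    proof -
      have "f \<in> F \<longleftrightarrow> f \<in> F \<inter> D" using f by simp
      with A[OF that] f show ?thesis by (elim disjE bexE) (auto simp: doubleton_eq_iff)
    qed
    then have "Q A f = {F \<in> A. f \<in> F}" unfolding Q_def by blast
    then have "sum c (Q A f) = (\<Sum>F\<in>A. if f \<in> F then c F else 0)"
      using that(2) by (simp add: sum.inter_filter)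
    also have "\<dots> = (\<Sum>F\<in>A. c F * indicator F f)"
      by (intro sum.cong) (simp_all add: indicator_def)
    finally show ?thesis .
  qed
  have c_f: "sum c (Q B1 f) = x f" "sum d (Q B2 f) = x f" if "f \<in> D'" for f
  proof -
    have f: "f \<in> E1" "f \<in> E2" using that unfolding D'_def D_def by auto
    show "sum c (Q B1 f) = x f"
      using weight[OF that finB(1) trace1[folded D_def], of c] c(2)[of f] f by simp
    show "sum d (Q B2 f) = x f"
      using weight[OF that finB(2) trace2[folded D_def], of d] d(2)[of f] f by simp
  qed
  \<comment> \<open>The share of the trace \<open>{e0, f}\<close>: product weights normalized by the
    common total \<open>x f\<close>.\<close>
  define y where "y f g = inverse (x f) *
    (\<Sum>F\<in>Q B1 f. \<Sum>F'\<in>Q B2 f. c F * d F' * indicator (F \<union> F') g)" for f g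
  define z where "z g = ((\<Sum>F\<in>R B1. c F * indicator F g) + (\<Sum>F\<in>R B2. d F * indicator F g))
    + (\<Sum>f\<in>D'. y f g)" for g
  have "z \<in> generated_cone (indicator ` B)"
    unfolding z_def y_def
    by (intro generated_cone_add generated_cone_sum generated_cone_scale generated_cone_scaled)
      (use finR finD c(1) d(1) nonneg B in \<open>auto simp: R_def Q_def D'_def D_def\<close>)
  moreover have "x = z"
  proof
    fix g
    consider "g \<in> E1" | "g \<in> E2" | "g \<notin> E1 \<union> E2" by blast
    then show "x g = z g"
    proof cases
      case 1
      \<comment> \<open>For \<open>g\<close> in \<open>E1\<close>, if \<open>g\<close> lies in the
        second set of a pair then it is a common edge and, the traces being equal, lies in the first
        set as well. Hence only the first marginal is seen.\<close>
      have "y f g = (\<Sum>F\<in>Q B1 f. c F * indicator F g)" if "f \<in> D'" for f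
        unfolding y_def using 1 B2
        by (intro sum_pairs_indicator finR c c_f that) (auto simp: Q_def D_def)
      moreover have "(\<Sum>F\<in>R B2. d F * indicator F g) = 0"
        using 1 B2 by (intro sum.neutral) (auto simp: R_def D_def indicator_def)
      moreover have "x g = (\<Sum>F\<in>B1. c F * indicator F g)" using c(2)[of g] 1 by simp
      ultimately show ?thesis
        using split[OF finB(1) trace1[folded D_def], of "\<lambda>F. c F * indicator F g"]
        unfolding z_def by simp
    next
      case 2
      have "y f g = (\<Sum>F\<in>Q B2 f. d F * indicator F g)" if "f \<in> D'" for f
      proof -
        have "y f g = inverse (x f) *
          (\<Sum>F'\<in>Q B2 f. \<Sum>F\<in>Q B1 f. d F' * c F * indicator (F' \<union> F) g)"
          unfolding y_def by (subst sum.swap) (simp add: Un_commute mult.commute)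
        also have "\<dots> = (\<Sum>F\<in>Q B2 f. d F * indicator F g)"
          using 2 B1 by (intro sum_pairs_indicator finR d c_f that) (auto simp: Q_def D_def)
        finally show ?thesis .
      qed
      moreover have "(\<Sum>F\<in>R B1. c F * indicator F g) = 0"
        using 2 B1 by (intro sum.neutral) (auto simp: R_def D_def indicator_def)
      moreover have "x g = (\<Sum>F\<in>B2. d F * indicator F g)" using d(2)[of g] 2 by simp
      ultimately show ?thesis
        using split[OF finB(2) trace2[folded D_def], of "\<lambda>F. d F * indicator F g"]
        unfolding z_def by simp
    next
      case 3
      have 31: "g \<notin> F" if "F \<in> B1" for F using that B1 3 by blast
      have 32: "g \<notin> F" if "F \<in> B2" for F using that B2 3 by blast
      show ?thesis
        using 3 31 32 supp unfolding z_def y_def by (simp add: R_def Q_def)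
    qed
  qed
  ultimately show ?thesis by simp
qed

text \<open>A ratio test: \<open>t\<close> is the least \<open>a i / b i\<close> over the indices
  with \<open>0 < b i\<close>. At the other indices a positive step cannot decrease the
  value.\<close>

lemma exists_max_step:
  fixes a b :: "'i \<Rightarrow> real"
  assumes "finite I" "\<And>i. i \<in> I \<Longrightarrow> 0 \<le> a i" "\<And>i. i \<in> I \<Longrightarrow> 0 < b i \<Longrightarrow> 0 < a i"
    and "j \<in> I" "0 < b j"
  shows "\<exists>t>0. (\<forall>i\<in>I. 0 \<le> a i - t * b i) \<and> (\<exists>i\<in>I. 0 < b i \<and> a i - t * b i = 0)"
proof -
  define J where "J = {i \<in> I. 0 < b i}"
  have J: "finite J" "J \<noteq> {}" using assms unfolding J_def by auto
  define t where "t = Min ((\<lambda>i. a i / b i) ` J)"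
  have "t \<in> (\<lambda>i. a i / b i) ` J" unfolding t_def using J by (intro Min_in) auto
  then obtain i where i: "i \<in> J" "t = a i / b i" by blast
  have t: "0 < t" using i assms(3) unfolding J_def by auto
  have "0 \<le> a k - t * b k" if "k \<in> I" for k
  proof (cases "k \<in> J")
    case True
    then have "t \<le> a k / b k" unfolding t_def using J by auto
    then show ?thesis using True unfolding J_def by (simp add: pos_le_divide_eq)
  next
    case False
    then have "t * b k \<le> 0" using t that unfolding J_def by (simp add: mult_le_0_iff)
    then show ?thesis using assms(2)[OF that] by simp
  qed
  then show ?thesis using t i unfolding J_def by (intro exI[of _ t]) auto
qed

section \<open>Balanced vectors with the cut condition\<close>

text \<open>\<open>\<sigma> e v\<close> is nonzero iff \<open>v\<close> is an end of \<open>e\<close>, and its sign is the color of that half-edge. The two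
  halves of an edge may have different colors because shrinking recolors only one of them.\<close>
locale signed_graph =
  fixes V :: "'v set" and E :: "'e set" and \<sigma> :: "'e \<Rightarrow> 'v \<Rightarrow> real"
  assumes finite_V: "finite V" and finite_E: "finite E"
    and ends_in_V: "e \<in> E \<Longrightarrow> \<sigma> e v \<noteq> 0 \<Longrightarrow> v \<in> V"
    and two_ends: "e \<in> E \<Longrightarrow> card {v. \<sigma> e v \<noteq> 0} = 2"
    and sign: "\<sigma> e v \<in> {-1, 0, 1}"

definition balanced :: "'v set \<Rightarrow> 'e set \<Rightarrow> ('e \<Rightarrow> 'v \<Rightarrow> real) \<Rightarrow> ('e \<Rightarrow> real) \<Rightarrow> bool" where
  "balanced V E \<sigma> x \<longleftrightarrow> (\<forall>v\<in>V. (\<Sum>e\<in>E. \<sigma> e v * x e) = 0)"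

definition edge_cut :: "'e set \<Rightarrow> ('e \<Rightarrow> 'v \<Rightarrow> real) \<Rightarrow> 'v set \<Rightarrow> 'e set" where
  "edge_cut E \<sigma> S = {e \<in> E. (\<exists>u\<in>S. \<sigma> e u \<noteq> 0) \<and> (\<exists>u. u \<notin> S \<and> \<sigma> e u \<noteq> 0)}"

text \<open>Here the cut condition takes the place of membership in the cone of the cycles; in this
  form the assumptions on \<open>x\<close> survive the shrinking of a tight cut.\<close>

definition feasible :: "'v set \<Rightarrow> 'e set \<Rightarrow> ('e \<Rightarrow> 'v \<Rightarrow> real) \<Rightarrow> ('e \<Rightarrow> real) \<Rightarrow> bool" where
  "feasible V E \<sigma> x \<longleftrightarrow> (\<forall>e. e \<notin> E \<longrightarrow> x e = 0) \<and> (\<forall>e. 0 \<le> x e) \<and> balanced V E \<sigma> x \<and>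
    (\<forall>S. S \<subseteq> V \<longrightarrow> (\<forall>e\<in>edge_cut E \<sigma> S. 2 * x e \<le> sum x (edge_cut E \<sigma> S)))"

text \<open>The sets whose indicators are balanced; feasible vectors will be decomposed into
  these.\<close>

definition balanced_sets :: "'v set \<Rightarrow> 'e set \<Rightarrow> ('e \<Rightarrow> 'v \<Rightarrow> real) \<Rightarrow> 'e set set" where
  "balanced_sets V E \<sigma> = {F. F \<subseteq> E \<and> (\<forall>v\<in>V. (\<Sum>e\<in>F. \<sigma> e v) = 0)}"

context signed_graph
begin

lemma other_end: "e \<in> E \<Longrightarrow> \<sigma> e u \<noteq> 0 \<Longrightarrow> \<exists>!w. w \<noteq> u \<and> \<sigma> e w \<noteq> 0"
  using two_ends[of e] unfolding card_2_iff' by (metis (mono_tags, lifting) mem_Collect_eq)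

lemma finite_cut: "finite (edge_cut E \<sigma> S)"
  using finite_E unfolding edge_cut_def by simp

lemma cut_compl: "edge_cut E \<sigma> (V - S) = edge_cut E \<sigma> S"
  using ends_in_V unfolding edge_cut_def by blast

lemma balanced_indicator:
  "F \<in> balanced_sets V E \<sigma> \<Longrightarrow> balanced V E \<sigma> (indicator F)"
proof -
  assume F: "F \<in> balanced_sets V E \<sigma>"
  then have "(\<Sum>e\<in>E. \<sigma> e v * indicator F e) = (\<Sum>e\<in>F. \<sigma> e v)" for v
    using finite_E unfolding balanced_sets_def by (intro sum.mono_neutral_cong_right) auto
  then show ?thesis using F unfolding balanced_def balanced_sets_def by simp
qed

text \<open>Around a single vertex the cut condition follows from balance, since the excess of the cut
  over \<open>2 * x e\<close> is twice the weight of the other edges that have the sign of \<open>e\<close> there.\<close>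
lemma cut_condition_singleton:
  assumes "balanced V E \<sigma> x" "\<And>f. 0 \<le> x f" "e \<in> edge_cut E \<sigma> {v}"
  shows "2 * x e \<le> sum x (edge_cut E \<sigma> {v})"
proof -
  let ?D = "edge_cut E \<sigma> {v}"
  have e: "e \<in> E" "\<sigma> e v \<noteq> 0" using assms(3) unfolding edge_cut_def by auto
  have D: "?D = {f \<in> E. \<sigma> f v \<noteq> 0}"
    unfolding edge_cut_def using other_end by blast
  have "(\<Sum>f\<in>?D. \<sigma> f v * x f) = (\<Sum>f\<in>E. \<sigma> f v * x f)"
    unfolding D using finite_E by (intro sum.mono_neutral_left) auto
  also have "\<dots> = 0" using assms(1) e ends_in_V unfolding balanced_def by blast
  finally have "(\<Sum>f\<in>?D. \<sigma> e v * (\<sigma> f v * x f)) = 0" by (simp add: sum_distrib_left[symmetric])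
  then have "sum x ?D = (\<Sum>f\<in>?D. x f + \<sigma> e v * (\<sigma> f v * x f))" by (simp add: sum.distrib)
  also have "\<dots> \<ge> x e + \<sigma> e v * (\<sigma> e v * x e)"
  proof (rule member_le_sum[OF assms(3) _ finite_cut])
    fix f assume "f \<in> ?D - {e}"
    show "0 \<le> x f + \<sigma> e v * (\<sigma> f v * x f)"
      using assms(2)[of f] sign[of e v] sign[of f v] by auto
  qed
  moreover have "x e + \<sigma> e v * (\<sigma> e v * x e) = 2 * x e" using sign[of e v] e by auto
  ultimately show ?thesis by simp
qed

text \<open>Complementary sets have the same cut, so the side with at most one vertex may be
  considered. It is not empty because \<open>e\<close> has an end in it, and a single vertex is
  covered by \<open>cut_condition_singleton\<close>.\<close>

lemma cut_condition_trivial: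
  assumes "balanced V E \<sigma> x" "\<And>f. 0 \<le> x f" "S \<subseteq> V" "card S \<le> 1 \<or> card (V - S) \<le> 1"
    and "e \<in> edge_cut E \<sigma> S"
  shows "2 * x e \<le> sum x (edge_cut E \<sigma> S)"
proof -
  have *: "2 * x e \<le> sum x (edge_cut E \<sigma> T)" if "T \<subseteq> V" "card T \<le> 1" "e \<in> edge_cut E \<sigma> T" for T
  proof -
    have "T \<noteq> {}" using that(3) unfolding edge_cut_def by auto
    moreover have "finite T" using that(1) finite_V finite_subset by blast
    ultimately have "card T = 1" using that(2) by (simp add: le_Suc_eq)
    then obtain v where "T = {v}" by (auto simp: card_1_singleton_iff)
    then show ?thesis using cut_condition_singleton assms(1,2) that(3) by simp
  qed
  show ?thesis using *[of S] *[of "V - S"] assms(3-5) cut_compl by auto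
qed

text \<open>Suited to the induction: the cuts left to check are those whose sides can both be shrunk
  to obtain a graph with fewer vertices.\<close>

lemma feasibleI:
  assumes "\<And>e. e \<notin> E \<Longrightarrow> x e = 0" "\<And>e. 0 \<le> x e" "balanced V E \<sigma> x"
    and "\<And>S e. S \<subseteq> V \<Longrightarrow> 2 \<le> card S \<Longrightarrow> 2 \<le> card (V - S) \<Longrightarrow> e \<in> edge_cut E \<sigma> S \<Longrightarrow>
      2 * x e \<le> sum x (edge_cut E \<sigma> S)"
  shows "feasible V E \<sigma> x"
  unfolding feasible_def
proof (intro conjI allI impI ballI)
  fix S e assume S: "S \<subseteq> V" "e \<in> edge_cut E \<sigma> S"
  show "2 * x e \<le> sum x (edge_cut E \<sigma> S)"
  proof (cases "2 \<le> card S \<and> 2 \<le> card (V - S)")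
    case False
    then show ?thesis using cut_condition_trivial[OF assms(3,2) S(1) _ S(2)] by linarith
  qed (use assms(4) S in blast)
qed (use assms in auto)

end

section \<open>The matched graph of half-edges\<close>

definition half_edges :: "'e set \<Rightarrow> ('e \<Rightarrow> 'v \<Rightarrow> real) \<Rightarrow> ('e \<times> 'v) set" where
  "half_edges H \<sigma> = {(e, v). e \<in> H \<and> \<sigma> e v \<noteq> 0}"

text \<open>The matching for \<open>kotzig\<close>: it exchanges the two halves of an edge. The
  description is unique by \<open>other_end\<close>.\<close>

definition opposite :: "('e \<Rightarrow> 'v \<Rightarrow> real) \<Rightarrow> 'e \<times> 'v \<Rightarrow> 'e \<times> 'v" where
  "opposite \<sigma> = (\<lambda>(e, u). (e, THE w. w \<noteq> u \<and> \<sigma> e w \<noteq> 0))"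

text \<open>The adjacency for \<open>kotzig\<close>: passing through a vertex with a change of sign.
  An alternating cycle of half-edges thus traverses whole edges and changes sign at each vertex it
  passes.\<close>

definition transition :: "'e set \<Rightarrow> ('e \<Rightarrow> 'v \<Rightarrow> real) \<Rightarrow> 'e \<times> 'v \<Rightarrow> 'e \<times> 'v \<Rightarrow> bool" where
  "transition H \<sigma> p q \<longleftrightarrow> p \<in> half_edges H \<sigma> \<and> q \<in> half_edges H \<sigma> \<and> snd p = snd q \<and>
    \<sigma> (fst p) (snd p) \<noteq> \<sigma> (fst q) (snd q)"

context signed_graph
begin

lemma opposite:
  assumes "e \<in> E" "\<sigma> e u \<noteq> 0"
  obtains w where "opposite \<sigma> (e, u) = (e, w)" "opposite \<sigma> (e, w) = (e, u)" "w \<noteq> u" "\<sigma> e w \<noteq> 0"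
    "\<And>v. \<sigma> e v \<noteq> 0 \<Longrightarrow> v = u \<or> v = w"
proof -
  obtain w where w: "w \<noteq> u" "\<sigma> e w \<noteq> 0" "\<And>v. v \<noteq> u \<Longrightarrow> \<sigma> e v \<noteq> 0 \<Longrightarrow> v = w"
    using other_end[OF assms] by blast
  have "(THE v. v \<noteq> u \<and> \<sigma> e v \<noteq> 0) = w" by (rule the_equality) (use w in blast)+
  moreover have "(THE v. v \<noteq> w \<and> \<sigma> e v \<noteq> 0) = u"
    by (rule the_equality) (use w assms(2) in blast)+
  ultimately have "opposite \<sigma> (e, u) = (e, w)" "opposite \<sigma> (e, w) = (e, u)"
    unfolding opposite_def by simp_all
  then show thesis using that w by blast
qed

lemma matched_graph_half_edges:
  assumes "H \<subseteq> E"
  shows "matched_graph (half_edges H \<sigma>) (opposite \<sigma>) (transition H \<sigma>)"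
proof
  have "half_edges H \<sigma> \<subseteq> E \<times> V" using assms ends_in_V unfolding half_edges_def by auto
  then show "finite (half_edges H \<sigma>)" using finite_E finite_V finite_subset by blast
next
  fix p assume "p \<in> half_edges H \<sigma>"
  then obtain e u where p: "p = (e, u)" "e \<in> H" "\<sigma> e u \<noteq> 0" unfolding half_edges_def by auto
  then obtain w where w: "opposite \<sigma> (e, u) = (e, w)" "opposite \<sigma> (e, w) = (e, u)" "w \<noteq> u"
    "\<sigma> e w \<noteq> 0" using assms by (blast elim: opposite)
  show "opposite \<sigma> p \<in> half_edges H \<sigma>" "opposite \<sigma> (opposite \<sigma> p) = p" "opposite \<sigma> p \<noteq> p"
    using p w unfolding half_edges_def by auto
qed (auto simp: transition_def intro: sympI)

text \<open>Each matched pair sits at one vertex with signs 1 and -1, and so cancels.\<close>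

lemma transition_matching_balanced:
  assumes "pmatch (transition H \<sigma>) Y"
  shows "finite Y \<and> (\<Sum>p\<in>Y. if snd p = v then \<sigma> (fst p) v else 0) = 0"
  using assms
proof (induction rule: pmatch.induct)
  case (insert2 A p q)
  have pq: "\<sigma> (fst p) (snd p) \<noteq> 0" "\<sigma> (fst q) (snd p) \<noteq> 0" "snd q = snd p"
    "\<sigma> (fst p) (snd p) \<noteq> \<sigma> (fst q) (snd p)"
    using insert2.hyps(5) unfolding transition_def half_edges_def by auto
  then have "\<sigma> (fst p) (snd p) + \<sigma> (fst q) (snd p) = 0"
    using sign[of "fst p" "snd p"] sign[of "fst q" "snd p"] by auto
  then show ?case using insert2.IH insert2.hyps(2-4) pq(3) by auto
qed simp

text \<open>\<open>kotzig\<close> is applied to the half-edges of the support \<open>H\<close>. A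
  bridge would produce a cut in which only one edge has positive weight, contrary to the cut
  condition.\<close>

lemma exists_balanced_set:
  assumes "feasible V E \<sigma> x" "x \<noteq> (\<lambda>_. 0)"
  shows "\<exists>F\<in>balanced_sets V E \<sigma>. F \<noteq> {} \<and> (\<forall>e\<in>F. 0 < x e)"
proof -
  have nonneg: "0 \<le> x e" and supp: "e \<notin> E \<Longrightarrow> x e = 0" and bal: "balanced V E \<sigma> x"
    and cut_x: "S \<subseteq> V \<Longrightarrow> e \<in> edge_cut E \<sigma> S \<Longrightarrow> 2 * x e \<le> sum x (edge_cut E \<sigma> S)" for e S
    using assms(1) unfolding feasible_def by auto
  define H where "H = {e \<in> E. 0 < x e}"
  have HE: "H \<subseteq> E" unfolding H_def by auto
  let ?X = "half_edges H \<sigma>" and ?m = "opposite \<sigma>" and ?N = "transition H \<sigma>"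
  interpret h: matched_graph ?X ?m ?N using matched_graph_half_edges[OF HE] .
  obtain e where "x e \<noteq> 0" using assms(2) by auto
  then have e: "e \<in> H" using nonneg[of e] supp[of e] unfolding H_def by force
  then have "card {v. \<sigma> e v \<noteq> 0} = 2" using two_ends HE by auto
  then have "{v. \<sigma> e v \<noteq> 0} \<noteq> {}" by (metis card.empty zero_neq_numeral)
  then have X: "?X \<noteq> {}" using e unfolding half_edges_def by auto
  \<comment> \<open>If all edges of the support at \<open>v\<close> had the sign of \<open>f\<close>
    there, the signed sum at \<open>v\<close> could not vanish.\<close>
  have both: "\<exists>h\<in>H. \<sigma> h v \<noteq> 0 \<and> \<sigma> h v \<noteq> \<sigma> f v" if "f \<in> H" "\<sigma> f v \<noteq> 0" for f v
  proof (rule ccontr)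
    assume "\<not> ?thesis"
    then have same: "\<sigma> h v = 0 \<or> \<sigma> h v = \<sigma> f v" if "h \<in> H" for h using that by auto
    have "(\<Sum>h\<in>E. \<sigma> f v * (\<sigma> h v * x h)) = 0"
      using bal ends_in_V[of f v] that HE unfolding balanced_def
      by (simp add: sum_distrib_left[symmetric] subset_iff)
    moreover have "0 < (\<Sum>h\<in>E. \<sigma> f v * (\<sigma> h v * x h))"
    proof (rule sum_pos2[OF finite_E, of f])
      show "f \<in> E" using that HE by auto
      show "0 < \<sigma> f v * (\<sigma> f v * x f)" using that sign[of f v] unfolding H_def by auto
      fix h assume h: "h \<in> E"
      show "0 \<le> \<sigma> f v * (\<sigma> h v * x h)"
      proof (cases "h \<in> H")
        case True
        then show ?thesis using same[OF True] sign[of f v] nonneg[of h] by auto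
      next
        case False
        then have "x h = 0" using nonneg[of h] h unfolding H_def by auto
        then show ?thesis by simp
      qed
    qed
    ultimately show False by simp
  qed
  have "\<exists>y\<in>S. \<exists>z\<in>?X - S. ?N y z"
    if S: "a \<in> S" "S \<subseteq> ?X" "?m a \<notin> S" "\<forall>y\<in>S. y \<noteq> a \<longrightarrow> ?m y \<in> S" for a S
  proof (rule ccontr)
    assume "\<not> ?thesis"
    then have closed: "z \<in> S" if "y \<in> S" "?N y z" for y z
      using that unfolding transition_def by blast
    \<comment> \<open>The vertices met by \<open>S\<close>. As \<open>S\<close> is closed under
      transitions, it will turn out to contain every half-edge of the support at these
      vertices.\<close>
    define T where "T = {v. \<exists>f. (f, v) \<in> S}"
    have SX: "f \<in> H" "\<sigma> f v \<noteq> 0" if "(f, v) \<in> S" for f v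
      using that S(2) unfolding half_edges_def by auto
    have full: "(f, v) \<in> S" if fv: "f \<in> H" "\<sigma> f v \<noteq> 0" "v \<in> T" for f v
    proof -
      obtain g where g: "(g, v) \<in> S" using fv(3) unfolding T_def by auto
      note gH = SX[OF g]
      show ?thesis
      proof (cases "\<sigma> f v = \<sigma> g v")
        case False
        then show ?thesis using closed[OF g, of "(f, v)"] fv gH
          unfolding transition_def half_edges_def by auto
      next
        case True
        \<comment> \<open>A half-edge of the same sign is reached by two transitions, through one of
          the other sign.\<close>
        obtain h where h: "h \<in> H" "\<sigma> h v \<noteq> 0" "\<sigma> h v \<noteq> \<sigma> g v" using both[OF gH] by auto
        have hS: "(h, v) \<in> S" using closed[OF g, of "(h, v)"] h gH
          unfolding transition_def half_edges_def by auto
        show ?thesis using closed[OF hS, of "(f, v)"] h fv True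
          unfolding transition_def half_edges_def by auto
      qed
    qed
    obtain e u where a: "a = (e, u)" by (cases a)
    have eu: "e \<in> H" "\<sigma> e u \<noteq> 0" using SX S(1) a by auto
    then have eE: "e \<in> E" using HE by auto
    obtain w where w: "?m (e, u) = (e, w)" "w \<noteq> u" "\<sigma> e w \<noteq> 0"
      using opposite[OF eE eu(2)] by metis
    have "w \<notin> T" using full[of e w] eu w S(3) a by auto
    moreover have "u \<in> T" using S(1) a unfolding T_def by auto
    ultimately have e_cut: "e \<in> edge_cut E \<sigma> T" using eu eE w unfolding edge_cut_def by blast
    \<comment> \<open>Were \<open>f\<close> in the support, \<open>S\<close> would contain its half
      in \<open>T\<close> and, being closed under \<open>opposite\<close> except at
      \<open>a\<close>, the other half too; then both ends of \<open>f\<close> would lie in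
      \<open>T\<close>.\<close>
    have "x f = 0" if f: "f \<in> edge_cut E \<sigma> T" "f \<noteq> e" for f
    proof (rule ccontr)
      assume "x f \<noteq> 0"
      then have fH: "f \<in> H" using f nonneg[of f] unfolding H_def edge_cut_def by auto
      obtain v v' where v: "v \<in> T" "\<sigma> f v \<noteq> 0" "v' \<notin> T" "\<sigma> f v' \<noteq> 0"
        using f(1) unfolding edge_cut_def by auto
      have "(f, v) \<in> S" using full fH v by auto
      then have "?m (f, v) \<in> S" using S(4) f(2) a by auto
      moreover have "?m (f, v) = (f, v')"
        using fH HE v by (metis opposite subsetD)
      ultimately show False using v(3) unfolding T_def by auto
    qed
    then have "sum x (edge_cut E \<sigma> T) = x e"
      using e_cut finite_cut by (simp add: sum.remove)
    moreover have "T \<subseteq> V" using SX HE ends_in_V unfolding T_def by blast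
    ultimately have "2 * x e \<le> x e" using cut_x e_cut by metis
    then show False using eu unfolding H_def by auto
  qed
  then obtain Y where Y: "Y \<subseteq> ?X" "Y \<noteq> {}" "?m ` Y \<subseteq> Y" "pmatch ?N Y"
    using kotzig[OF h.matched_graph_axioms X] by metis
  define F where "F = fst ` Y"
  have FH: "F \<subseteq> H" using Y(1) unfolding F_def half_edges_def by auto
  \<comment> \<open>Closed under \<open>opposite\<close>, \<open>Y\<close> contains both halves of
    each of its edges. The signed sum of \<open>F\<close> at a vertex is therefore that of the
    half-edges of \<open>Y\<close> there.\<close>
  have full: "(e, v) \<in> Y" if ev: "e \<in> F" "\<sigma> e v \<noteq> 0" for e v
  proof -
    obtain u where u: "(e, u) \<in> Y" using ev(1) unfolding F_def by auto
    then have eE: "e \<in> E" "\<sigma> e u \<noteq> 0" using Y(1) HE unfolding half_edges_def by auto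
    obtain w where "?m (e, u) = (e, w)" "v = u \<or> v = w" using opposite[OF eE] ev(2) by metis
    moreover have "?m (e, u) \<in> Y" using u Y(3) by auto
    ultimately show ?thesis using u by auto
  qed
  have "(\<Sum>e\<in>F. \<sigma> e v) = 0" for v
  proof -
    have fin: "finite Y" and zero: "(\<Sum>p\<in>Y. if snd p = v then \<sigma> (fst p) v else 0) = 0"
      using transition_matching_balanced[OF Y(4)] by auto
    have "(\<Sum>e\<in>F. \<sigma> e v) = (\<Sum>e\<in>{e \<in> F. \<sigma> e v \<noteq> 0}. \<sigma> e v)"
      using fin unfolding F_def by (intro sum.mono_neutral_right) auto
    also have "\<dots> = (\<Sum>p\<in>{p \<in> Y. snd p = v}. \<sigma> (fst p) v)"
      using full Y(1) unfolding F_def half_edges_def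
      by (intro sum.reindex_bij_witness[of _ fst "\<lambda>e. (e, v)"]) auto
    also have "\<dots> = 0" using zero fin by (simp add: sum.inter_filter)
    finally show ?thesis .
  qed
  then have "F \<in> balanced_sets V E \<sigma>" using FH HE unfolding balanced_sets_def by auto
  then show ?thesis using FH Y(2) unfolding F_def H_def by (intro bexI[of _ "fst ` Y"]) auto
qed

end

text \<open>The half-edge signs after shrinking the complement of \<open>S\<close> to the vertex \<open>a\<close>: the edges of the
  cut around \<open>S\<close> end in \<open>a\<close>, where \<open>e0\<close> is positive and all the others are negative, so that
  balance at \<open>a\<close> is tightness of the cut at \<open>e0\<close>.\<close>
definition shrink_sign ::
  "('e \<Rightarrow> 'v \<Rightarrow> real) \<Rightarrow> 'v set \<Rightarrow> 'v \<Rightarrow> 'e \<Rightarrow> 'e \<Rightarrow> 'v \<Rightarrow> real" where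
  "shrink_sign \<sigma> S a e0 e v = (if v \<in> S then \<sigma> e v
    else if v = a \<and> (\<exists>u\<in>S. \<sigma> e u \<noteq> 0) \<and> (\<exists>u. u \<notin> S \<and> \<sigma> e u \<noteq> 0) then if e = e0 then 1 else -1
    else 0)"

section \<open>Shrinking one side of a tight cut\<close>

text \<open>The shrunk vertex is represented by some \<open>a\<close> outside \<open>S\<close>, so
  that the smaller graph has vertices of the same type and the induction hypothesis applies to
  it.\<close>

locale tight_cut = signed_graph V E \<sigma> for V :: "'v set" and E :: "'e set" and \<sigma> +
  fixes x :: "'e \<Rightarrow> real" and S :: "'v set" and a :: 'v and e0 :: 'e
  assumes feas: "feasible V E \<sigma> x"
    and S_V: "S \<subseteq> V" and a_V: "a \<in> V - S"
    and e0_cut: "e0 \<in> edge_cut E \<sigma> S" and tight: "2 * x e0 = sum x (edge_cut E \<sigma> S)"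
begin

abbreviation "E' \<equiv> {e \<in> E. \<exists>u\<in>S. \<sigma> e u \<noteq> 0}"
abbreviation "\<sigma>' \<equiv> shrink_sign \<sigma> S a e0"

lemma shrink_sign_S: "v \<in> S \<Longrightarrow> \<sigma>' e v = \<sigma> e v"
  unfolding shrink_sign_def by simp

lemma shrink_sign_a:
  "e \<in> E \<Longrightarrow> \<sigma>' e a = (if e \<in> edge_cut E \<sigma> S then if e = e0 then 1 else -1 else 0)"
  using a_V unfolding shrink_sign_def edge_cut_def by auto

lemma shrink_sign_nonzero:
  "e \<in> E \<Longrightarrow> \<sigma>' e v \<noteq> 0 \<longleftrightarrow> (v \<in> S \<and> \<sigma> e v \<noteq> 0) \<or> (v = a \<and> e \<in> edge_cut E \<sigma> S)"
  using a_V unfolding shrink_sign_def edge_cut_def by auto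

lemma signed_graph_shrink: "signed_graph (insert a S) E' \<sigma>'"
proof
  show "finite (insert a S)" "finite E'" using finite_V finite_E S_V finite_subset by auto
  show "v \<in> insert a S" if "e \<in> E'" "\<sigma>' e v \<noteq> 0" for e v
    using that shrink_sign_nonzero by auto
  show "\<sigma>' e v \<in> {- 1, 0, 1}" for e v
    using sign[of e v] unfolding shrink_sign_def by auto
  fix e assume e: "e \<in> E'"
  then obtain u where u: "u \<in> S" "\<sigma> e u \<noteq> 0" "e \<in> E" by blast
  then obtain w where w: "w \<noteq> u" "\<sigma> e w \<noteq> 0" "\<And>v. \<sigma> e v \<noteq> 0 \<Longrightarrow> v = u \<or> v = w"
    using other_end[of e u] by blast
  show "card {v. \<sigma>' e v \<noteq> 0} = 2"
  proof (cases "w \<in> S")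
    case True
    then have "e \<notin> edge_cut E \<sigma> S" using u w unfolding edge_cut_def by auto
    then have "{v. \<sigma>' e v \<noteq> 0} = {u, w}" using shrink_sign_nonzero[OF u(3)] u w True by auto
    then show ?thesis using w(1) by auto
  next
    case False
    then have "e \<in> edge_cut E \<sigma> S" using u w unfolding edge_cut_def by auto
    then have "{v. \<sigma>' e v \<noteq> 0} = {u, a}"
      using shrink_sign_nonzero[OF u(3)] u w False by auto
    moreover have "u \<noteq> a" using u(1) a_V by auto
    ultimately show ?thesis by simp
  qed
qed

text \<open>Undoing the shrinking replaces \<open>a\<close> by the whole complement of
  \<open>S\<close>. Each cut of the smaller graph is thereby a cut of the given one, and the cut
  condition is inherited.\<close>

lemma cut_shrink:
  assumes "T \<subseteq> insert a S"
  shows "edge_cut E' \<sigma>' T = edge_cut E \<sigma> (if a \<in> T then T \<union> (V - S) else T)"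
proof -
  have "e \<in> edge_cut E' \<sigma>' T \<longleftrightarrow> e \<in> edge_cut E \<sigma> (if a \<in> T then T \<union> (V - S) else T)" if e: "e \<in> E" for e
  proof -
    obtain u w where uw: "\<And>v. \<sigma> e v \<noteq> 0 \<longleftrightarrow> v = u \<or> v = w"
      using two_ends[OF e] unfolding card_2_iff by blast
    have V: "u \<in> V" "w \<in> V" using ends_in_V[OF e] uw by blast+
    have cut: "e \<in> edge_cut E \<sigma> T' \<longleftrightarrow> (u \<in> T' \<or> w \<in> T') \<and> (u \<notin> T' \<or> w \<notin> T')" for T'
      using e unfolding edge_cut_def mem_Collect_eq uw by blast
    have "e \<in> edge_cut E' \<sigma>' T \<longleftrightarrow> (u \<in> S \<or> w \<in> S) \<and>
      ((u \<in> S \<and> u \<in> T) \<or> (w \<in> S \<and> w \<in> T) \<or> (a \<in> T \<and> e \<in> edge_cut E \<sigma> S)) \<and>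
      ((u \<in> S \<and> u \<notin> T) \<or> (w \<in> S \<and> w \<notin> T) \<or> (a \<notin> T \<and> e \<in> edge_cut E \<sigma> S))"
      using e unfolding edge_cut_def[of E'] mem_Collect_eq shrink_sign_nonzero[OF e] uw by blast
    moreover have "u \<in> T \<Longrightarrow> u = a \<or> u \<in> S" "w \<in> T \<Longrightarrow> w = a \<or> w \<in> S" "a \<notin> S"
      using assms a_V by auto
    ultimately show ?thesis using V unfolding cut by auto
  qed
  moreover have "edge_cut E' \<sigma>' T \<subseteq> E" "edge_cut E \<sigma> T' \<subseteq> E" for T' unfolding edge_cut_def by auto
  ultimately show ?thesis by blast
qed

text \<open>Nothing changes at the vertices of \<open>S\<close>. At \<open>a\<close> the signed sum
  is \<open>2 * x e0\<close> minus the weight of the cut, which is \<open>0\<close> by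
  tightness.\<close>

lemma balanced_shrink:
  "balanced (insert a S) E' \<sigma>' (\<lambda>e. x e * indicator E' e)"
proof -
  have "(\<Sum>e\<in>E'. \<sigma>' e v * (x e * indicator E' e)) = 0" if "v \<in> S" for v
  proof -
    have "(\<Sum>e\<in>E'. \<sigma>' e v * (x e * indicator E' e)) = (\<Sum>e\<in>E. \<sigma> e v * x e)"
      using finite_E that
      by (intro sum.mono_neutral_cong_left) (auto simp: shrink_sign_S)
    then show ?thesis using feas that S_V unfolding feasible_def balanced_def by auto
  qed
  moreover have "(\<Sum>e\<in>E'. \<sigma>' e a * (x e * indicator E' e)) = 0"
  proof -
    let ?D = "edge_cut E \<sigma> S"
    have "(\<Sum>e\<in>E'. \<sigma>' e a * (x e * indicator E' e)) = (\<Sum>e\<in>?D. if e = e0 then x e else - x e)"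
      using finite_E by (intro sum.mono_neutral_cong_right) (auto simp: shrink_sign_a edge_cut_def)
    also have "\<dots> = x e0 + (\<Sum>e\<in>?D - {e0}. - x e)"
      by (subst sum.remove[OF finite_cut e0_cut]) (auto intro!: sum.cong)
    also have "\<dots> = 2 * x e0 - sum x ?D"
      using sum.remove[OF finite_cut e0_cut, of x] by (simp add: sum_negf)
    finally show ?thesis using tight by simp
  qed
  ultimately show ?thesis unfolding balanced_def by auto
qed

lemma feasible_shrink: "feasible (insert a S) E' \<sigma>' (\<lambda>e. x e * indicator E' e)"
  unfolding feasible_def
proof (intro conjI allI impI ballI)
  fix T e assume T: "T \<subseteq> insert a S" "e \<in> edge_cut E' \<sigma>' T"
  let ?T = "if a \<in> T then T \<union> (V - S) else T"
  have "?T \<subseteq> V" using T(1) S_V a_V by auto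
  then have "2 * x e \<le> sum x (edge_cut E \<sigma> ?T)"
    using feas T unfolding feasible_def cut_shrink[OF T(1)] by blast
  moreover have "(\<Sum>e\<in>edge_cut E' \<sigma>' T. x e * indicator E' e) = sum x (edge_cut E' \<sigma>' T)"
    by (rule sum.cong) (auto simp: edge_cut_def)
  moreover have "e \<in> E'" using T(2) unfolding edge_cut_def by auto
  ultimately show "2 * (x e * indicator E' e) \<le> (\<Sum>e\<in>edge_cut E' \<sigma>' T. x e * indicator E' e)"
    using cut_shrink[OF T(1)] by simp
qed (use feas balanced_shrink in \<open>auto simp: feasible_def\<close>)

text \<open>Balance at \<open>a\<close> says that \<open>F\<close> contains as many cut edges other
  than \<open>e0\<close> as it contains copies of \<open>e0\<close>, which is none or one.\<close>

lemma balanced_set_trace: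
  assumes "F \<in> balanced_sets (insert a S) E' \<sigma>'"
  shows "F \<inter> edge_cut E \<sigma> S = {} \<or> (\<exists>f\<in>edge_cut E \<sigma> S - {e0}. F \<inter> edge_cut E \<sigma> S = {e0, f})"
proof -
  let ?D = "edge_cut E \<sigma> S"
  have F: "F \<subseteq> E'" "(\<Sum>e\<in>F. \<sigma>' e a) = 0" using assms unfolding balanced_sets_def by auto
  have FE: "F \<subseteq> E" using F(1) by auto
  have fin: "finite F" using FE finite_E finite_subset by blast
  have "(\<Sum>e\<in>F. \<sigma>' e a) = (\<Sum>e\<in>F \<inter> ?D. if e = e0 then 1 else -1)"
    using FE fin
    by (intro sum.mono_neutral_cong_right) (auto simp: shrink_sign_a subset_iff)
  then have sum0: "(\<Sum>e\<in>F \<inter> ?D. if e = e0 then 1 else -1 :: real) = 0" using F(2) by simp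
  show ?thesis
  proof (cases "e0 \<in> F")
    case False
    then have "(\<Sum>e\<in>F \<inter> ?D. if e = e0 then 1 else -1 :: real) = (\<Sum>e\<in>F \<inter> ?D. -1)"
      by (intro sum.cong) auto
    then have "card (F \<inter> ?D) = 0" using sum0 by simp
    then show ?thesis using fin by simp
  next
    case True
    then have mem: "e0 \<in> F \<inter> ?D" using e0_cut by simp
    have "(\<Sum>e\<in>F \<inter> ?D. if e = e0 then 1 else -1 :: real) = 1 + (\<Sum>e\<in>F \<inter> ?D - {e0}. -1)"
      using fin by (subst sum.remove[OF _ mem]) (auto intro!: sum.cong)
    then have "card (F \<inter> ?D - {e0}) = 1" using sum0 by simp
    then obtain f where f: "F \<inter> ?D - {e0} = {f}" by (auto simp: card_1_singleton_iff)
    then have "F \<inter> ?D = {e0, f}" "f \<in> ?D - {e0}" using mem by blast+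
    then show ?thesis by blast
  qed
qed

end

section \<open>Decomposing feasible vectors into balanced sets\<close>

text \<open>In \<open>s\<close> the complement of \<open>S\<close> is shrunk, in \<open>c\<close>
  the set \<open>S\<close> itself. Both graphs are smaller than the given one since each side has at
  least two vertices, and their common edges are those of the cut. The two decompositions are joined
  by \<open>glue_cones\<close>.\<close>

lemma (in signed_graph) feasible_in_cone_tight:
  assumes feas: "feasible V E \<sigma> x" and S: "S \<subseteq> V" "2 \<le> card S" "2 \<le> card (V - S)"
    and e0: "e0 \<in> edge_cut E \<sigma> S" "2 * x e0 = sum x (edge_cut E \<sigma> S)"
    and IH: "\<And>V' E' \<sigma>' x'. card V' < card V \<Longrightarrow> signed_graph V' E' \<sigma>' \<Longrightarrow> feasible V' E' \<sigma>' x' \<Longrightarrow>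
      x' \<in> generated_cone (indicator ` balanced_sets (V' :: 'v set) (E' :: 'e set) \<sigma>')"
  shows "x \<in> generated_cone (indicator ` balanced_sets V E \<sigma>)"
proof -
  obtain a where a: "a \<in> V - S" using S(3) by (metis card.empty ex_in_conv not_numeral_le_zero)
  obtain b where b: "b \<in> S" using S(2) by (metis card.empty ex_in_conv not_numeral_le_zero)
  have finS: "finite S" "finite (V - S)" using S(1) finite_V finite_subset by auto
  have card: "card V = card S + card (V - S)"
    using card_Diff_subset[OF finS(1) S(1)] card_mono[OF finite_V S(1)] by simp
  have VVS: "V - (V - S) = S" using S(1) by auto
  interpret s: tight_cut V E \<sigma> x S a e0
    by unfold_locales (use feas S(1) a e0 in auto)
  interpret c: tight_cut V E \<sigma> x "V - S" b e0
    by unfold_locales (use feas b e0 cut_compl VVS in auto)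
  let ?D = "edge_cut E \<sigma> S"
  have D: "s.E' \<inter> c.E' = ?D"
    unfolding edge_cut_def using ends_in_V by blast
  have E: "e \<in> s.E' \<union> c.E'" if "e \<in> E" for e
  proof -
    have "{v. \<sigma> e v \<noteq> 0} \<noteq> {}" using two_ends[OF that] by (metis card.empty zero_neq_numeral)
    then show ?thesis using ends_in_V[OF that] that by blast
  qed
  let ?B1 = "balanced_sets (insert a S) s.E' s.\<sigma>'"
  let ?B2 = "balanced_sets (insert b (V - S)) c.E' c.\<sigma>'"
  have B1: "F \<subseteq> s.E'" "v \<in> S \<Longrightarrow> (\<Sum>e\<in>F. \<sigma> e v) = 0" if "F \<in> ?B1" for F v
    using that s.shrink_sign_S unfolding balanced_sets_def by auto
  have B2: "F \<subseteq> c.E'" "v \<in> V - S \<Longrightarrow> (\<Sum>e\<in>F. \<sigma> e v) = 0" if "F \<in> ?B2" for F v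
    using that c.shrink_sign_S unfolding balanced_sets_def by auto
  \<comment> \<open>All edges of \<open>E\<close> at a vertex of \<open>S\<close> belong to
    \<open>s.E'\<close>, and all those at a vertex of \<open>V - S\<close> to \<open>c.E'\<close>.
    Balance of \<open>F\<close> can hence be checked on its two restrictions.\<close>
  have glued: "F \<in> balanced_sets V E \<sigma>"
    if F: "F \<subseteq> E" "F \<inter> s.E' = F1" "F \<inter> c.E' = F2"
      and F1: "\<And>v. v \<in> S \<Longrightarrow> (\<Sum>e\<in>F1. \<sigma> e v) = 0"
      and F2: "\<And>v. v \<in> V - S \<Longrightarrow> (\<Sum>e\<in>F2. \<sigma> e v) = 0" for F F1 F2
  proof -
    have fin: "finite F" using F(1) finite_E finite_subset by blast
    have "(\<Sum>e\<in>F. \<sigma> e v) = (\<Sum>e\<in>F1. \<sigma> e v)" if "v \<in> S" for v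
      using fin F that by (intro sum.mono_neutral_right) auto
    moreover have "(\<Sum>e\<in>F. \<sigma> e v) = (\<Sum>e\<in>F2. \<sigma> e v)" if "v \<in> V - S" for v
      using fin F that by (intro sum.mono_neutral_right) auto
    ultimately have "(\<Sum>e\<in>F. \<sigma> e v) = 0" if "v \<in> V" for v
      using that F1[of v] F2[of v] by (cases "v \<in> S") auto
    then show ?thesis using F(1) unfolding balanced_sets_def by auto
  qed
  show ?thesis
  proof (rule glue_cones[of s.E' c.E' ?B1 e0 ?B2])
    show "finite s.E'" "finite c.E'" using finite_E by auto
    show "F \<inter> (s.E' \<inter> c.E') = {} \<or> (\<exists>f\<in>s.E' \<inter> c.E' - {e0}. F \<inter> (s.E' \<inter> c.E') = {e0, f})"
      if "F \<in> ?B1" for F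
      unfolding D using s.balanced_set_trace[OF that] .
    show "F \<inter> (s.E' \<inter> c.E') = {} \<or> (\<exists>f\<in>s.E' \<inter> c.E' - {e0}. F \<inter> (s.E' \<inter> c.E') = {e0, f})"
      if "F \<in> ?B2" for F
      unfolding D using c.balanced_set_trace[OF that] unfolding cut_compl .
    have "card (insert a S) < card V" "card (insert b (V - S)) < card V"
      using card S(2,3) a b finS by simp_all
    then show "(\<lambda>e. x e * indicator s.E' e) \<in> generated_cone (indicator ` ?B1)"
      "(\<lambda>e. x e * indicator c.E' e) \<in> generated_cone (indicator ` ?B2)"
      using IH s.signed_graph_shrink s.feasible_shrink c.signed_graph_shrink c.feasible_shrink
      by blast+
    show "0 \<le> x e" for e using feas unfolding feasible_def by auto
    show "x e = 0" if "e \<notin> s.E' \<union> c.E'" for e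
      using feas E that unfolding feasible_def by blast
    show "F \<in> balanced_sets V E \<sigma>" if F: "F \<in> ?B1" "F \<inter> (s.E' \<inter> c.E') = {}" for F
    proof (rule glued)
      show "F \<inter> s.E' = F" "F \<inter> c.E' = {}" "F \<subseteq> E" using B1(1)[OF F(1)] F(2) by blast+
    qed (use B1(2)[OF F(1)] in auto)
    show "F \<in> balanced_sets V E \<sigma>" if F: "F \<in> ?B2" "F \<inter> (s.E' \<inter> c.E') = {}" for F
    proof (rule glued)
      show "F \<inter> s.E' = {}" "F \<inter> c.E' = F" "F \<subseteq> E" using B2(1)[OF F(1)] F(2) by blast+
    qed (use B2(2)[OF F(1)] in auto)
    show "F1 \<union> F2 \<in> balanced_sets V E \<sigma>"
      if F: "F1 \<in> ?B1" "F2 \<in> ?B2" "F1 \<inter> (s.E' \<inter> c.E') = F2 \<inter> (s.E' \<inter> c.E')" for F1 F2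
    proof (rule glued)
      show "(F1 \<union> F2) \<inter> s.E' = F1" "(F1 \<union> F2) \<inter> c.E' = F2" "F1 \<union> F2 \<subseteq> E"
        using B1(1)[OF F(1)] B2(1)[OF F(2)] F(3) by blast+
    qed (use B1(2)[OF F(1)] B2(2)[OF F(2)] in auto)
  qed (use B1(1) B2(1) in auto)
qed

text \<open>The outer induction on the number of vertices deals with tight cuts, the inner one on
  the size of the support with the subtraction of a balanced set.\<close>

lemma feasible_in_cone:
  assumes "signed_graph V E \<sigma>" "feasible V E \<sigma> x"
  shows "x \<in> generated_cone (indicator ` balanced_sets V E \<sigma>)"
  using assms
proof (induction "card V" arbitrary: V E \<sigma> x rule: less_induct)
  case (less V E \<sigma> x)
  interpret signed_graph V E \<sigma> by fact
  \<comment> \<open>The cuts that can be shrunk, paired with their edges: the places where tightness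
    is looked for.\<close>
  define P where "P = {(S, e). S \<subseteq> V \<and> 2 \<le> card S \<and> 2 \<le> card (V - S) \<and> e \<in> edge_cut E \<sigma> S}"
  have P: "S \<subseteq> V" "2 \<le> card S" "2 \<le> card (V - S)" "e \<in> edge_cut E \<sigma> S" if "(S, e) \<in> P" for S e
    using that unfolding P_def by simp_all
  have finP: "finite P"
    by (rule finite_subset[of _ "Pow V \<times> E"])
      (auto simp: P_def edge_cut_def finite_V finite_E)
  have tight_case: "y \<in> generated_cone (indicator ` balanced_sets V E \<sigma>)"
    if "feasible V E \<sigma> y" "(S, e) \<in> P" "2 * y e = sum y (edge_cut E \<sigma> S)" for y S e
    by (rule feasible_in_cone_tight[OF that(1) P[OF that(2)] that(3)]) (rule less.hyps)
  from less.prems(2) show ?case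
  proof (induction "card {e \<in> E. x e \<noteq> 0}" arbitrary: x rule: less_induct)
    case (less x)
    have nonneg: "\<And>e. 0 \<le> x e" and supp: "\<And>e. e \<notin> E \<Longrightarrow> x e = 0" and bal: "balanced V E \<sigma> x"
      and cut_x: "\<And>S e. S \<subseteq> V \<Longrightarrow> e \<in> edge_cut E \<sigma> S \<Longrightarrow> 2 * x e \<le> sum x (edge_cut E \<sigma> S)"
      using less.prems unfolding feasible_def by auto
    consider "x = (\<lambda>_. 0)" | S e where "(S, e) \<in> P" "2 * x e = sum x (edge_cut E \<sigma> S)"
      | "x \<noteq> (\<lambda>_. 0)" "\<And>S e. (S, e) \<in> P \<Longrightarrow> 2 * x e \<noteq> sum x (edge_cut E \<sigma> S)" by blast
    then show ?case
    proof cases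
      case 1
      then show ?thesis using generated_cone_zero by simp
    next
      case 2
      then show ?thesis by (rule tight_case[OF less.prems])
    next
      case 3
      obtain F where F: "F \<in> balanced_sets V E \<sigma>" "F \<noteq> {}" "\<forall>e\<in>F. 0 < x e"
        using exists_balanced_set[OF less.prems 3(1)] by blast
      have FE: "F \<subseteq> E" using F(1) unfolding balanced_sets_def by auto
      \<comment> \<open>The slacks that have to stay nonnegative, all linear in \<open>y\<close>:
        the weight of an edge of \<open>F\<close>, or the excess in the cut condition for a pair in
        \<open>P\<close>. At \<open>x\<close> they are positive.\<close>
      define l where "l i y = (case i of Inl e \<Rightarrow> y e | Inr (S, e) \<Rightarrow> sum y (edge_cut E \<sigma> S) - 2 * y e)"
        for i :: "'b + 'a set \<times> 'b" and y :: "'b \<Rightarrow> real"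
      define I where "I = Inl ` F \<union> Inr ` P"
      obtain f where f: "f \<in> F" using F(2) by blast
      have "\<exists>t>0. (\<forall>i\<in>I. 0 \<le> l i x - t * l i (indicator F)) \<and>
        (\<exists>i\<in>I. 0 < l i (indicator F) \<and> l i x - t * l i (indicator F) = 0)"
      proof (rule exists_max_step)
        show "finite I" using finP finite_subset[OF FE finite_E] unfolding I_def by simp
        show pos: "0 < l i x" if "i \<in> I" for i
        proof (cases i)
          case (Inl e)
          then show ?thesis using that F(3) unfolding I_def l_def by auto
        next
          case (Inr p)
          then have "p \<in> P" using that unfolding I_def by auto
          then obtain S e where p: "i = Inr (S, e)" "(S, e) \<in> P"
            using Inr by (metis surj_pair)
          then have "2 * x e < sum x (edge_cut E \<sigma> S)"
            using 3(2)[OF p(2)] cut_x[OF P(1) P(4), OF p(2) p(2)] by simp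
          then show ?thesis using p(1) unfolding l_def by simp
        qed
        then show "0 \<le> l i x" if "i \<in> I" for i using that by (simp add: less_imp_le)
        show "Inl f \<in> I" "0 < l (Inl f) (indicator F)" using f unfolding I_def l_def by auto
      qed
      then obtain t where t: "0 < t" "\<forall>i\<in>I. 0 \<le> l i x - t * l i (indicator F)"
        "\<exists>i\<in>I. l i x - t * l i (indicator F) = 0" by blast
      define y where "y e = x e - t * indicator F e" for e
      have l_y: "l i y = l i x - t * l i (indicator F)" for i
        unfolding l_def y_def
        by (auto split: sum.splits prod.splits
            simp: sum_subtractf sum_distrib_left[symmetric] algebra_simps)
      have y_nonneg: "0 \<le> y e" for e
      proof (cases "e \<in> F")
        case True
        then have "0 \<le> l (Inl e) y" using t(2) l_y unfolding I_def by simp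
        then show ?thesis unfolding l_def by simp
      qed (use nonneg in \<open>simp add: y_def\<close>)
      have y_bal: "balanced V E \<sigma> y"
        using bal balanced_indicator[OF F(1)] unfolding balanced_def y_def
        by (simp add: right_diff_distrib sum_subtractf mult.left_commute sum_distrib_left[symmetric])
      have y_feas: "feasible V E \<sigma> y"
      proof (rule feasibleI)
        show "2 * y e \<le> sum y (edge_cut E \<sigma> S)"
          if "S \<subseteq> V" "2 \<le> card S" "2 \<le> card (V - S)" "e \<in> edge_cut E \<sigma> S" for S e
        proof -
          have "Inr (S, e) \<in> I" using that unfolding I_def P_def by auto
          then have "0 \<le> l (Inr (S, e)) y" using t(2) l_y by simp
          then show ?thesis unfolding l_def by simp
        qed
        show "y e = 0" if "e \<notin> E" for e using that supp FE unfolding y_def by (auto simp: indicator_def)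
      qed (use y_nonneg y_bal in auto)
      \<comment> \<open>A slack that the maximal step brings to zero: either an edge leaves the
        support, or a cut becomes tight.\<close>
      obtain i where i: "i \<in> I" "l i y = 0" using t(3) l_y by auto
      have "y \<in> generated_cone (indicator ` balanced_sets V E \<sigma>)"
      proof (cases i)
        case (Inl e)
        then have e: "e \<in> F" "y e = 0" using i unfolding I_def l_def by auto
        have "{f \<in> E. y f \<noteq> 0} \<subseteq> {f \<in> E. x f \<noteq> 0}"
          using F(3) unfolding y_def by (auto simp: indicator_def)
        moreover have "e \<in> {f \<in> E. x f \<noteq> 0}" "e \<notin> {f \<in> E. y f \<noteq> 0}" using e F(3) FE by auto
        ultimately have "{f \<in> E. y f \<noteq> 0} \<subset> {f \<in> E. x f \<noteq> 0}" by blast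
        then have "card {f \<in> E. y f \<noteq> 0} < card {f \<in> E. x f \<noteq> 0}"
          using finite_E by (intro psubset_card_mono) auto
        then show ?thesis using less.hyps y_feas by blast
      next
        case (Inr p)
        then have "p \<in> P" using i(1) unfolding I_def by auto
        moreover obtain S e where "p = (S, e)" by (cases p)
        ultimately have "(S, e) \<in> P" "2 * y e = sum y (edge_cut E \<sigma> S)"
          using i(2) Inr unfolding l_def by simp_all
        then show ?thesis by (rule tight_case[OF y_feas])
      qed
      moreover have "(\<lambda>e. t * indicator F e) \<in> generated_cone (indicator ` balanced_sets V E \<sigma>)"
        using F(1) t(1) by (intro generated_cone_scaled) auto
      ultimately have "(\<lambda>e. y e + t * indicator F e) \<in> generated_cone (indicator ` balanced_sets V E \<sigma>)"
        by (rule generated_cone_add)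
      then show ?thesis unfolding y_def by simp
    qed
  qed
qed

section \<open>Alternating trails and cycles\<close>

text \<open>Both halves of an edge receive the sign of its color, so that \<open>balanced\<close>
  compares the red and the blue sums at each vertex.\<close>

definition color_sign :: "('v, 'e) mgraph \<Rightarrow> ('e \<Rightarrow> color) \<Rightarrow> 'e \<Rightarrow> 'v \<Rightarrow> real" where
  "color_sign G C e v = (if v \<in> ends G e then if C e = Red then 1 else -1 else 0)"

abbreviation alternating :: "('e \<Rightarrow> color) \<Rightarrow> 'e list \<Rightarrow> bool" where
  "alternating C es \<equiv> \<forall>i. Suc i < length es \<longrightarrow> C (es ! i) \<noteq> C (es ! Suc i)"

lemma sum_nth_distinct:
  "distinct es \<Longrightarrow> (\<Sum>i<length es. f (es ! i)) = sum f (set es)"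
  by (rule sum.reindex_bij_betw) (rule bij_betw_nth, simp_all)

lemma char_vec_trail:
  assumes "is_trail G (vs, es)"
  shows "char_vec (vs, es) = indicator (set es)"
proof
  fix e
  have d: "distinct es" using assms unfolding is_trail_def by simp
  have "char_vec (vs, es) e = (\<Sum>f\<in>set es. unit_vec f e)"
    unfolding char_vec_def using sum_nth_distinct[OF d, of "\<lambda>f. unit_vec f e"] by simp
  also have "\<dots> = indicator (set es) e"
    unfolding unit_vec_def by (simp add: indicator_def)
  finally show "char_vec (vs, es) e = indicator (set es) e" .
qed

lemma walk_hd_last:
  assumes "is_walk G (vs, es)"
  shows "hd vs = vs ! 0" "last vs = vs ! length es"
proof -
  have len: "length vs = Suc (length es)" using assms unfolding is_walk_def by simp
  then have "vs \<noteq> []" by auto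
  then show "hd vs = vs ! 0" "last vs = vs ! length es"
    using len by (simp_all add: hd_conv_nth last_conv_nth)
qed

lemma generated_cone_base: "y \<in> S \<Longrightarrow> y \<in> generated_cone S"
  using generated_cone_scaled[of y S 1] by simp

locale colored_graph =
  fixes G :: "('v, 'e) mgraph" and C :: "'e \<Rightarrow> color"
  assumes finite_graph: "finite_mgraph G"
begin

abbreviation "\<sigma> \<equiv> color_sign G C"

lemma ends: "e \<in> edges G \<Longrightarrow> ends G e \<subseteq> verts G \<and> card (ends G e) = 2"
  and finite_edges: "finite (edges G)" and finite_verts: "finite (verts G)"
  using finite_graph unfolding finite_mgraph_def by auto

sublocale signed_graph "verts G" "edges G" \<sigma>
proof
  show "card {v. \<sigma> e v \<noteq> 0} = 2" if "e \<in> edges G" for e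
  proof -
    have "{v. \<sigma> e v \<noteq> 0} = ends G e" unfolding color_sign_def by auto
    then show ?thesis using ends[OF that] by simp
  qed
next
  show "v \<in> verts G" if "e \<in> edges G" "\<sigma> e v \<noteq> 0" for e v
    using ends[OF that(1)] that(2) unfolding color_sign_def by (auto split: if_splits)
qed (auto simp: finite_edges finite_verts color_sign_def)

lemma walk_step:
  assumes "is_walk G (vs, es)" "i < length es"
  shows "es ! i \<in> edges G" "ends G (es ! i) = {vs ! i, vs ! Suc i}" "vs ! i \<noteq> vs ! Suc i"
    "vs ! i \<in> verts G" "vs ! Suc i \<in> verts G"
proof -
  show e: "es ! i \<in> edges G" and E: "ends G (es ! i) = {vs ! i, vs ! Suc i}"
    using assms unfolding is_walk_def by auto
  show "vs ! i \<noteq> vs ! Suc i" "vs ! i \<in> verts G" "vs ! Suc i \<in> verts G"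
    using ends[OF e] unfolding E by auto
qed

text \<open>The final half of one edge and the initial half of the next lie at the same vertex with
  opposite signs. The sum telescopes to the first and the last half-edge.\<close>

lemma alternating_sum_nth:
  assumes W: "is_walk G (vs, es)" and alt: "alternating C es" and "k < length es"
  shows "(\<Sum>i<Suc k. \<sigma> (es ! i) v) =
    (if vs ! 0 = v then \<sigma> (es ! 0) v else 0) + (if vs ! Suc k = v then \<sigma> (es ! k) v else 0)"
  using assms(3)
proof (induction k)
  case 0
  then show ?case using walk_step[OF W, of 0] by (auto simp: color_sign_def)
next
  case (Suc k)
  note a = walk_step[OF W Suc_lessD[OF Suc.prems]] and b = walk_step[OF W Suc.prems]
  have "(\<Sum>i<Suc k. \<sigma> (es ! i) v) =
    (if vs ! 0 = v then \<sigma> (es ! 0) v else 0) + (if vs ! Suc k = v then \<sigma> (es ! k) v else 0)"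
    using Suc by simp
  moreover have "C (es ! k) \<noteq> C (es ! Suc k)" using alt Suc.prems by simp
  then have "\<sigma> (es ! Suc k) v + (if vs ! Suc k = v then \<sigma> (es ! k) v else 0) =
    (if vs ! Suc (Suc k) = v then \<sigma> (es ! Suc k) v else 0)"
    using a b by (cases "C (es ! k)"; cases "C (es ! Suc k)") (auto simp: color_sign_def)
  ultimately show ?case by simp
qed

lemma alternating_sum:
  assumes "is_trail G (vs, es)" "alternating C es" "es \<noteq> []"
  shows "(\<Sum>e\<in>set es. \<sigma> e v) =
    (if hd vs = v then \<sigma> (hd es) v else 0) + (if last vs = v then \<sigma> (last es) v else 0)"
proof -
  have W: "is_walk G (vs, es)" and d: "distinct es" using assms(1) unfolding is_trail_def by auto
  have "hd es = es ! 0" "last es = es ! (length es - 1)"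
    using assms(3) by (simp_all add: hd_conv_nth last_conv_nth)
  moreover have "Suc (length es - 1) = length es" using assms(3) by (cases es) auto
  ultimately show ?thesis
    using alternating_sum_nth[OF W assms(2), of "length es - 1" v] assms(3) walk_hd_last[OF W]
    by (simp add: sum_nth_distinct[OF d, of "\<lambda>e. \<sigma> e v", symmetric])
qed

text \<open>The two half-edges left by \<open>alternating_sum\<close> meet at the closing vertex,
  where they cancel because the first and last colors differ.\<close>

lemma CAT_balanced:
  assumes "is_CAT G C (vs, es)"
  shows "set es \<in> balanced_sets (verts G) (edges G) \<sigma>"
proof -
  have T: "is_trail G (vs, es)" "alternating C es" "es \<noteq> []" "hd vs = last vs"
    "C (last es) \<noteq> C (hd es)"
    using assms unfolding is_CAT_def is_closed_def by auto
  have W: "is_walk G (vs, es)" using T(1) unfolding is_trail_def by auto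
  have es: "set es \<subseteq> edges G" using W unfolding is_walk_def by auto
  have n: "0 < length es" "length es - 1 < length es" "Suc (length es - 1) = length es"
    using T(3) by (cases es; simp)+
  have "hd vs \<in> ends G (hd es)" "last vs \<in> ends G (last es)"
    using walk_step(2)[OF W n(1)] walk_step(2)[OF W n(2)] walk_hd_last[OF W] n(3) T(3)
    by (auto simp: hd_conv_nth last_conv_nth)
  then have "\<sigma> (hd es) (hd vs) + \<sigma> (last es) (hd vs) = 0"
    using T(4,5) by (cases "C (hd es)"; cases "C (last es)") (auto simp: color_sign_def)
  then have "(\<Sum>e\<in>set es. \<sigma> e v) = 0" for v
    unfolding alternating_sum[OF T(1-3)] using T(4) by auto
  then show ?thesis using es unfolding balanced_sets_def by auto
qed

text \<open>The signed sum is the red sum minus the blue sum. Nonnegativity extends to all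
  \<open>e\<close> because \<open>x\<close> vanishes outside the edges.\<close>

lemma alternating_cone_iff:
  "x \<in> alternating_cone G C \<longleftrightarrow> (\<forall>e. e \<notin> edges G \<longrightarrow> x e = 0) \<and> (\<forall>e. 0 \<le> x e) \<and>
    balanced (verts G) (edges G) \<sigma> x"
proof -
  have "(\<Sum>e\<in>edges G. \<sigma> e v * x e) =
    (\<Sum>e\<in>color_edges_at G C Red v. x e) - (\<Sum>e\<in>color_edges_at G C Blue v. x e)" for v
  proof -
    have "(\<Sum>e\<in>color_edges_at G C k v. x e) =
      (\<Sum>e\<in>edges G. if v \<in> ends G e \<and> C e = k then x e else 0)" for k
      unfolding color_edges_at_def using finite_edges by (simp add: sum.inter_filter)
    moreover have "\<sigma> e v * x e = (if v \<in> ends G e \<and> C e = Red then x e else 0) -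
      (if v \<in> ends G e \<and> C e = Blue then x e else 0)" for e
      unfolding color_sign_def by (cases "C e") auto
    ultimately show ?thesis by (simp add: sum_subtractf)
  qed
  then show ?thesis
    unfolding alternating_cone_def edge_space_def balanced_def
    by (simp only: mem_Collect_eq right_minus_eq) (metis order_refl)
qed

lemma generated_cone_alternating:
  assumes "S \<subseteq> alternating_cone G C"
  shows "generated_cone S \<subseteq> alternating_cone G C"
proof
  fix x assume "x \<in> generated_cone S"
  then obtain F c where F: "finite F" "F \<subseteq> S" "\<And>y. y \<in> F \<Longrightarrow> 0 \<le> c y"
    "x = (\<lambda>e. \<Sum>y\<in>F. c y * y e)" by (rule generated_coneE) blast
  have y: "e \<notin> edges G \<Longrightarrow> y e = 0" "0 \<le> y e" "balanced (verts G) (edges G) \<sigma> y"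
    if "y \<in> F" for y e
    using that F(2) assms alternating_cone_iff by blast+
  have "(\<Sum>e\<in>edges G. \<sigma> e v * x e) = 0" if "v \<in> verts G" for v
  proof -
    have "(\<Sum>e\<in>edges G. \<sigma> e v * x e) = (\<Sum>y\<in>F. c y * (\<Sum>e\<in>edges G. \<sigma> e v * y e))"
      unfolding F(4) sum_distrib_left
      by (subst sum.swap) (simp add: mult.left_commute)
    also have "\<dots> = 0" using y(3) that unfolding balanced_def by simp
    finally show ?thesis .
  qed
  moreover have "x e = 0" if "e \<notin> edges G" for e
    unfolding F(4) using y(1)[OF _ that] by (simp add: sum.neutral)
  moreover have "0 \<le> x e" for e using y(2) F(3,4) by (simp add: sum_nonneg)
  ultimately show "x \<in> alternating_cone G C" unfolding alternating_cone_iff balanced_def by simp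
qed

lemma trail_cone_subset_alternating: "trail_cone G C \<subseteq> alternating_cone G C"
  unfolding trail_cone_def
proof (rule generated_cone_alternating, safe)
  fix vs es assume W: "is_CAT G C (vs, es)"
  have "char_vec (vs, es) = indicator (set es)"
    using W char_vec_trail unfolding is_CAT_def by blast
  moreover note F = CAT_balanced[OF W]
  ultimately show "char_vec (vs, es) \<in> alternating_cone G C"
    using balanced_indicator[OF F] F
    unfolding alternating_cone_iff balanced_sets_def by (auto simp: indicator_def)
qed

text \<open>A longest alternating trail inside \<open>F\<close> is considered. If it were not a CAT,
  balance at its last vertex would supply an edge to prolong it.\<close>

lemma exists_CAT:
  assumes F: "F \<in> balanced_sets (verts G) (edges G) \<sigma>" "F \<noteq> {}"
  shows "\<exists>vs es. is_CAT G C (vs, es) \<and> set es \<subseteq> F"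
proof (rule ccontr)
  assume no_CAT: "\<not> ?thesis"
  have FE: "F \<subseteq> edges G" and bal: "v \<in> verts G \<Longrightarrow> (\<Sum>e\<in>F. \<sigma> e v) = 0" for v
    using F(1) unfolding balanced_sets_def by auto
  have finF: "finite F" using FE finite_edges finite_subset by blast
  let ?P = "\<lambda>(vs, es). is_trail G (vs, es) \<and> alternating C es \<and> es \<noteq> [] \<and> set es \<subseteq> F"
  obtain e where e: "e \<in> F" using F(2) by blast
  then have eE: "e \<in> edges G" using FE by auto
  obtain u w where "ends G e = {u, w}" using ends[OF eE] by (meson card_2_iff)
  then have "?P ([u, w], [e])"
    using e eE ends[OF eE] unfolding is_trail_def is_walk_def by auto
  moreover have "\<forall>W. ?P W \<longrightarrow> length (snd W) < Suc (card F)"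
    using finF by (auto simp: is_trail_def less_Suc_eq_le card_mono distinct_card[symmetric])
  ultimately obtain W where "?P W" and max: "\<And>W'. ?P W' \<Longrightarrow> length (snd W') \<le> length (snd W)"
    using ex_has_greatest_nat[of ?P "([u, w], [e])" "\<lambda>W. length (snd W)" "Suc (card F)"] by blast
  then obtain vs es where T: "is_trail G (vs, es)" "alternating C es" "es \<noteq> []" "set es \<subseteq> F"
    and longest: "\<And>vs' es'. ?P (vs', es') \<Longrightarrow> length es' \<le> length es"
    by (cases W) fastforce
  have walk: "is_walk G (vs, es)" using T(1) unfolding is_trail_def by simp
  then have len: "length vs = Suc (length es)" unfolding is_walk_def by simp
  have n: "length es - 1 < length es" "Suc (length es - 1) = length es"
    using T(3) by (cases es; simp)+
  define v where "v = last vs"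
  have v: "v = vs ! length es" "hd vs = vs ! 0" using walk_hd_last[OF walk] unfolding v_def by auto
  have last_es: "last es = es ! (length es - 1)" using T(3) by (simp add: last_conv_nth)
  have v_end: "v \<in> ends G (last es)" "v \<in> verts G"
    using walk_step(2,5)[OF walk n(1)] n(2) v last_es by auto
  define s where "s = \<sigma> (last es) v"
  have s: "s \<noteq> 0" "s * s = 1" using v_end unfolding s_def color_sign_def by auto
  \<comment> \<open>The product is 1 if the trail is open. If it is closed, it is 2: not being a
    CAT, the trail has first and last edges of the same color.\<close>
  have "0 < s * (\<Sum>e\<in>set es. \<sigma> e v)"
  proof (cases "hd vs = v")
    case True
    have "\<not> is_CAT G C (vs, es)" using no_CAT T(4) by blast
    then have "C (last es) = C (hd es)"
      using T(1-3) True unfolding is_CAT_def is_closed_def v_def by auto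
    moreover have "v \<in> ends G (hd es)"
      using walk_step(2)[OF walk, of 0] T(3) True v(2) by (simp add: hd_conv_nth)
    ultimately have "\<sigma> (hd es) v = s" using v_end unfolding s_def color_sign_def by simp
    then show ?thesis unfolding alternating_sum[OF T(1-3)]
      using True s by (simp add: v_def[symmetric] s_def[symmetric] distrib_left)
  next
    case False
    then show ?thesis unfolding alternating_sum[OF T(1-3)]
      using s by (simp add: v_def[symmetric] s_def[symmetric])
  qed
  moreover have "(\<Sum>e\<in>F. \<sigma> e v) = (\<Sum>e\<in>F - set es. \<sigma> e v) + (\<Sum>e\<in>set es. \<sigma> e v)"
    using finF T(4) by (rule sum.subset_diff[rotated])
  then have "s * (\<Sum>e\<in>set es. \<sigma> e v) = - (\<Sum>e\<in>F - set es. s * \<sigma> e v)"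
    using bal[OF v_end(2)] by (simp add: sum_distrib_left[symmetric] add_eq_0_iff)
  ultimately have "(\<Sum>e\<in>F - set es. s * \<sigma> e v) < 0" by simp
  then obtain f where f: "f \<in> F - set es" "s * \<sigma> f v < 0"
    by (meson not_le sum_nonneg)
  then have fv: "v \<in> ends G f" "C f \<noteq> C (last es)"
    using v_end unfolding s_def color_sign_def by (auto split: if_splits)
  have fE: "f \<in> edges G" using f FE by auto
  obtain a b where ab: "ends G f = {a, b}" using ends[OF fE] by (meson card_2_iff)
  then obtain z where z: "ends G f = {v, z}" using fv(1) by (metis insert_commute insertE singletonD)
  have "is_walk G (vs @ [z], es @ [f])"
    using walk len fE z ends[OF fE] v
    unfolding is_walk_def by (auto simp: nth_append less_Suc_eq)
  then have "is_trail G (vs @ [z], es @ [f])" using T(1) f(1) unfolding is_trail_def by auto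
  moreover have "alternating C (es @ [f])"
  proof (intro allI impI)
    fix i assume i: "Suc i < length (es @ [f])"
    show "C ((es @ [f]) ! i) \<noteq> C ((es @ [f]) ! Suc i)"
    proof (cases "Suc i < length es")
      case False
      then have "i = length es - 1" using i by simp
      then show ?thesis using fv(2) last_es n by (simp add: nth_append)
    qed (use T(2) in \<open>simp add: nth_append\<close>)
  qed
  ultimately have "?P (vs @ [z], es @ [f])" using T(4) f(1) by simp
  then show False using longest by fastforce
qed

text \<open>A CAT inside \<open>F\<close> is itself balanced, so removing it leaves a smaller
  balanced set; its characteristic vector is added back in the cone.\<close>

lemma balanced_set_in_trail_cone:
  assumes "F \<in> balanced_sets (verts G) (edges G) \<sigma>"
  shows "indicator F \<in> trail_cone G C"
proof -
  have "finite F" using assms finite_edges finite_subset unfolding balanced_sets_def by blast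
  then show ?thesis using assms
  proof (induction F rule: finite_psubset_induct)
    case (psubset F)
    show ?case
    proof (cases "F = {}")
      case True
      then show ?thesis
        using generated_cone_zero unfolding trail_cone_def indicator_def by simp
    next
      case False
      then obtain vs es where W: "is_CAT G C (vs, es)" "set es \<subseteq> F"
        using exists_CAT psubset.prems by blast
      have "es \<noteq> []" using W(1) unfolding is_CAT_def by simp
      then have "F - set es \<subset> F" using W(2) by (cases es) auto
      moreover have "F - set es \<in> balanced_sets (verts G) (edges G) \<sigma>"
        using psubset.prems CAT_balanced[OF W(1)] sum_diff[OF psubset.hyps(1) W(2), of "\<lambda>e. \<sigma> e _"]
        unfolding balanced_sets_def by auto
      ultimately have "indicator (F - set es) \<in> trail_cone G C" using psubset.IH by blast
      moreover have "indicator (set es) \<in> trail_cone G C"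
      proof -
        have "char_vec (vs, es) \<in> trail_cone G C"
          unfolding trail_cone_def using W(1) by (intro generated_cone_base) auto
        moreover have "char_vec (vs, es) = indicator (set es)"
          using W(1) char_vec_trail unfolding is_CAT_def by blast
        ultimately show ?thesis by simp
      qed
      ultimately have "(\<lambda>e. indicator (F - set es) e + indicator (set es) e) \<in> trail_cone G C"
        unfolding trail_cone_def by (rule generated_cone_add)
      moreover have "(\<lambda>e. indicator (F - set es) e + indicator (set es) e) = (indicator F :: 'e \<Rightarrow> real)"
        using W(2) by (auto simp: indicator_def fun_eq_iff)
      ultimately show ?thesis by simp
    qed
  qed
qed

end

section \<open>Closed trails, cycles and cuts\<close>

text \<open>A repeated vertex splits a closed trail into two shorter closed trails with disjoint
  edge sets. Without repetition the trail is a cycle or has no edges.\<close>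

lemma closed_trail_in_cycle_cone:
  assumes "is_trail G (vs, es)" "is_closed (vs, es)"
  shows "indicator (set es) \<in> cycle_cone G"
  using assms
proof (induction "length es" arbitrary: vs es rule: less_induct)
  case less
  have W: "is_walk G (vs, es)" and d: "distinct es" using less.prems unfolding is_trail_def by auto
  have len: "length vs = Suc (length es)" and vs: "set vs \<subseteq> verts G" and es: "set es \<subseteq> edges G"
    and step: "\<And>i. i < length es \<Longrightarrow> ends G (es ! i) = {vs ! i, vs ! Suc i}"
    using W unfolding is_walk_def by auto
  have closed: "vs ! 0 = vs ! length es"
    using less.prems(2) walk_hd_last[OF W] unfolding is_closed_def by simp
  consider "es = []" | "es \<noteq> []" "distinct (butlast vs)" | "\<not> distinct (butlast vs)" by blast
  then show ?case
  proof cases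
    case 1
    then show ?thesis
      using generated_cone_zero unfolding cycle_cone_def indicator_def by simp
  next
    case 2
    then have "is_cycle G (vs, es)" using less.prems unfolding is_cycle_def by simp
    then have "char_vec (vs, es) \<in> cycle_cone G"
      unfolding cycle_cone_def by (intro generated_cone_base) auto
    then show ?thesis using char_vec_trail[OF less.prems(1)] by simp
  next
    case 3
    \<comment> \<open>Since \<open>butlast\<close> omits the closing vertex,
      \<open>j < length es\<close>. This makes the segment from \<open>i\<close> to \<open>j\<close>
      shorter than the whole trail.\<close>
    then obtain i j where ij: "i < j" "j < length es" "vs ! i = vs ! j"
      using len by (auto simp: distinct_conv_nth nth_butlast, metis linorder_neqE_nat)
    define es1 where "es1 = take (j - i) (drop i es)"
    define vs1 where "vs1 = take (Suc (j - i)) (drop i vs)"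
    define es2 where "es2 = take i es @ drop j es"
    define vs2 where "vs2 = take i vs @ drop j vs"
    have es_split: "es = take i es @ es1 @ drop j es"
    proof -
      have "drop (j - i) (drop i es) = drop j es" using ij by simp
      then show ?thesis unfolding es1_def by (metis append_take_drop_id)
    qed
    have len1: "length es1 = j - i" "length vs1 = Suc (j - i)"
      unfolding es1_def vs1_def using ij len by auto
    have len2: "length es2 = i + (length es - j)" "length vs2 = Suc (i + (length es - j))"
      unfolding es2_def vs2_def using ij len by auto
    have set1: "set es1 \<subseteq> set es" "set vs1 \<subseteq> set vs"
      unfolding es1_def vs1_def by (meson order_trans set_drop_subset set_take_subset)+
    have set2: "set es2 \<subseteq> set es" "set vs2 \<subseteq> set vs"
      unfolding es2_def vs2_def by (auto dest: in_set_takeD in_set_dropD)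
    have "distinct (take i es @ es1 @ drop j es)" using d es_split by metis
    then have d12: "distinct es1" "distinct es2" "set es1 \<inter> set es2 = {}"
      unfolding es2_def by auto
    have set12: "set es = set es1 \<union> set es2"
      using arg_cong[OF es_split, of set] unfolding es2_def by auto
    have W1: "is_walk G (vs1, es1)"
      unfolding is_walk_def
    proof (intro case_prodI conjI allI impI)
      fix k assume "k < length es1"
      then show "ends G (es1 ! k) = {vs1 ! k, vs1 ! Suc k}"
        using step[of "i + k"] ij len len1 unfolding es1_def vs1_def by simp
    qed (use set1 vs es len1 in auto)
    have W2: "is_walk G (vs2, es2)"
      unfolding is_walk_def
    proof (intro case_prodI conjI allI impI)
      fix k assume k: "k < length es2"
      have e: "es2 ! k = (if k < i then es ! k else es ! (j + (k - i)))"
        using ij unfolding es2_def by (simp add: nth_append)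
      have v: "vs2 ! k' = (if k' < i then vs ! k' else vs ! (j + (k' - i)))" if "k' \<le> length es2" for k'
        using ij len len2 that unfolding vs2_def by (simp add: nth_append)
      show "ends G (es2 ! k) = {vs2 ! k, vs2 ! Suc k}"
      proof (cases "Suc k < i \<or> i \<le> k")
        case True
        then show ?thesis
          using e v[of k] v[of "Suc k"] step[of k] step[of "j + (k - i)"] k len2 ij
          by (auto simp: Suc_diff_le)
      next
        case False
        \<comment> \<open>The seam: after position \<open>k\<close>, \<open>vs2\<close> goes on with
          \<open>vs ! j\<close>, which equals \<open>vs ! i\<close>.\<close>
        then have "Suc k = i" by simp
        then show ?thesis using e v[of k] v[of "Suc k"] step[of k] k ij by auto
      qed
    qed (use set2 vs es len2 in auto)
    have "is_closed (vs1, es1)"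
      using walk_hd_last[OF W1] len1 ij len unfolding is_closed_def vs1_def by simp
    moreover have "vs2 ! 0 = vs2 ! length es2"
      using closed ij len len2(1) unfolding vs2_def by (auto simp: nth_append)
    then have "is_closed (vs2, es2)" using walk_hd_last[OF W2] unfolding is_closed_def by simp
    moreover have "length es1 < length es" "length es2 < length es" using len1 len2 ij by auto
    ultimately have "indicator (set es1) \<in> cycle_cone G" "indicator (set es2) \<in> cycle_cone G"
      using less.hyps W1 W2 d12(1,2) unfolding is_trail_def by auto
    then have "(\<lambda>e. indicator (set es1) e + indicator (set es2) e) \<in> cycle_cone G"
      unfolding cycle_cone_def by (rule generated_cone_add)
    moreover have "(\<lambda>e. indicator (set es1) e + indicator (set es2) e) = indicat_real (set es)"
      unfolding set12 using d12(3) by (auto simp: indicator_def fun_eq_iff)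
    ultimately show ?thesis by simp
  qed
qed

text \<open>Membership in \<open>S\<close> flips exactly at the counted steps.\<close>

lemma even_crossings_iff:
  "even (card {i. i < n \<and> (vs ! i \<in> S) \<noteq> (vs ! Suc i \<in> S)}) \<longleftrightarrow> (vs ! 0 \<in> S) = (vs ! n \<in> S)"
proof (induction n)
  case (Suc n)
  have "{i. i < Suc n \<and> (vs ! i \<in> S) \<noteq> (vs ! Suc i \<in> S)} =
    (if (vs ! n \<in> S) \<noteq> (vs ! Suc n \<in> S) then {n} else {}) \<union>
    {i. i < n \<and> (vs ! i \<in> S) \<noteq> (vs ! Suc i \<in> S)}"
    by (auto simp: less_Suc_eq)
  then show ?case using Suc by (auto simp: card_insert_if)
qed simp

context colored_graph
begin

text \<open>A closed walk crosses a cut an even number of times, so a cycle through \<open>e\<close>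
  contains at least two edges of the cut.\<close>

lemma cycle_cut_condition:
  assumes W: "is_cycle G (vs, es)" and e: "e \<in> edge_cut (edges G) \<sigma> S"
  shows "2 * indicator (set es) e \<le> (\<Sum>f\<in>edge_cut (edges G) \<sigma> S. indicat_real (set es) f)"
proof (cases "e \<in> set es")
  case True
  have walk: "is_walk G (vs, es)" and d: "distinct es"
    using W unfolding is_cycle_def is_trail_def by auto
  have len: "length vs = Suc (length es)" and es: "set es \<subseteq> edges G"
    using walk unfolding is_walk_def by auto
  have closed: "vs ! 0 = vs ! length es"
    using W walk_hd_last[OF walk] unfolding is_cycle_def is_closed_def by simp
  let ?D = "edge_cut (edges G) \<sigma> S"
  let ?K = "{i. i < length es \<and> (vs ! i \<in> S) \<noteq> (vs ! Suc i \<in> S)}"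
  have cross: "es ! i \<in> ?D \<longleftrightarrow> (vs ! i \<in> S) \<noteq> (vs ! Suc i \<in> S)" if "i < length es" for i
  proof -
    have "\<sigma> (es ! i) v \<noteq> 0 \<longleftrightarrow> v = vs ! i \<or> v = vs ! Suc i" for v
      using walk_step(2)[OF walk that] unfolding color_sign_def by auto
    then show ?thesis using walk_step(1)[OF walk that] unfolding edge_cut_def by auto
  qed
  have "even (card ?K)" using even_crossings_iff[of "length es" vs S] closed by simp
  \<comment> \<open>As the edges are distinct, crossing steps can be counted as edges of the
    cut.\<close>
  have "bij_betw ((!) es) ?K (set es \<inter> ?D)"
    using cross d by (auto simp: bij_betw_def inj_on_def nth_eq_iff_index_eq in_set_conv_nth)
  then have "card ?K = card (set es \<inter> ?D)" by (rule bij_betw_same_card)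
  with \<open>even (card ?K)\<close> have "even (card (set es \<inter> ?D))" by metis
  moreover have "card (set es \<inter> ?D) \<noteq> 0" using True e by auto
  ultimately have "2 \<le> card (set es \<inter> ?D)" by (metis dvd_imp_le not_gr_zero)
  moreover have "(\<Sum>f\<in>?D. indicat_real (set es) f) = card (set es \<inter> ?D)"
    using finite_cut by (simp add: indicator_def sum.If_cases Int_commute)
  ultimately show ?thesis using True by simp
qed (simp add: sum_nonneg)

text \<open>Both sides are linear in \<open>x\<close>, so the inequality passes from cycles to their
  nonnegative combinations.\<close>

lemma cycle_cone_cut_condition:
  assumes "x \<in> cycle_cone G" "e \<in> edge_cut (edges G) \<sigma> S"
  shows "2 * x e \<le> sum x (edge_cut (edges G) \<sigma> S)"
proof -
  obtain F c where F: "finite F" "F \<subseteq> char_vec ` {W. is_cycle G W}" "\<And>y. y \<in> F \<Longrightarrow> 0 \<le> c y"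
    "x = (\<lambda>e. \<Sum>y\<in>F. c y * y e)"
    using assms(1) unfolding cycle_cone_def by (rule generated_coneE) blast
  have "2 * y e \<le> sum y (edge_cut (edges G) \<sigma> S)" if y: "y \<in> F" for y
  proof -
    obtain vs es where "is_cycle G (vs, es)" "y = char_vec (vs, es)" using y F(2) by auto
    then show ?thesis
      using cycle_cut_condition[OF _ assms(2)] char_vec_trail unfolding is_cycle_def by metis
  qed
  then have "(\<Sum>y\<in>F. c y * (2 * y e)) \<le> (\<Sum>y\<in>F. c y * sum y (edge_cut (edges G) \<sigma> S))"
    using F(3) by (intro sum_mono mult_left_mono)
  moreover have "sum x T = (\<Sum>y\<in>F. c y * sum y T)" for T
    unfolding F(4) by (subst sum.swap) (simp add: sum_distrib_left)
  moreover have "2 * x e = (\<Sum>y\<in>F. c y * (2 * y e))"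
    unfolding F(4) by (simp add: sum_distrib_left mult.left_commute)
  ultimately show ?thesis by simp
qed

section \<open>The remaining inclusions between the cones\<close>

lemma trail_cone_subset_cycle: "trail_cone G C \<subseteq> cycle_cone G"
  unfolding trail_cone_def cycle_cone_def
proof (rule generated_cone_subset, safe)
  fix vs es assume "is_CAT G C (vs, es)"
  then have "is_trail G (vs, es)" "is_closed (vs, es)" unfolding is_CAT_def by auto
  then show "char_vec (vs, es) \<in> generated_cone (char_vec ` {W. is_cycle G W})"
    using closed_trail_in_cycle_cone char_vec_trail unfolding cycle_cone_def by metis
qed

text \<open>The cone of the cycles provides the cut condition and the alternating cone the rest of
  feasibility. The balanced sets of the resulting decomposition are then split into CATs.\<close>

lemma alternating_Int_cycle_subset_trail: "alternating_cone G C \<inter> cycle_cone G \<subseteq> trail_cone G C"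
proof
  fix x assume x: "x \<in> alternating_cone G C \<inter> cycle_cone G"
  then have "feasible (verts G) (edges G) \<sigma> x"
    using cycle_cone_cut_condition alternating_cone_iff unfolding feasible_def by auto
  then have "x \<in> generated_cone (indicator ` balanced_sets (verts G) (edges G) \<sigma>)"
    by (rule feasible_in_cone[OF signed_graph_axioms])
  moreover have "generated_cone (indicator ` balanced_sets (verts G) (edges G) \<sigma>) \<subseteq> trail_cone G C"
    unfolding trail_cone_def
    using balanced_set_in_trail_cone by (intro generated_cone_subset) (auto simp: trail_cone_def)
  ultimately show "x \<in> trail_cone G C" by blast
qed

end

theorem theorem4p6:
  fixes G :: "('v, 'e) mgraph" and C :: "'e \<Rightarrow> color"
  assumes "finite_mgraph G"
  shows "trail_cone G C = alternating_cone G C \<inter> cycle_cone G"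
proof -
  interpret colored_graph G C using assms by unfold_locales
  show ?thesis
    using trail_cone_subset_alternating trail_cone_subset_cycle alternating_Int_cycle_subset_trail
    by blast
qed

end
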